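(* Let $f\in\mathcal{D}(\mathbb{T})$. If $f$ is cyclic for $\mathcal{D}(\mathbb{T})$, then $$\int_{\mathbb{T}}\log|f(\zeta)|\,|d\zeta|=-\infty\quad\text{and}\quad c(\mathcal{Z}(f))=0.$$
   Context: $\mathbb{T}$ is the unit circle, $|d\zeta|$ is arclength measure on it, and $\mathbb{N}=\{n\in\mathbb{Z}:n\ge 0\}$. The harmonic Dirichlet space $\mathcal{D}(\mathbb{T})$ is the Hilbert space of functions $f\in L^2(\mathbb{T})$ with $\|f\|_{\mathcal{D}(\mathbb{T})}^2:=\sum_{n\in\mathbb{Z}}(1+|n|)|\hat f(n)|^2<\infty$, where $\hat f(n)=\frac1{2\pi}\int_{\mathbb{T}}f(\zeta)\bar\zeta^{n}|d\zeta|$. For $f\in\mathcal{D}(\mathbb{T})$, $[f]_{\mathbb{N}}$ denotes the closure in $\mathcal{D}(\mathbb{T})$ of the linear span of $\{\zeta^n f(\zeta):n\in\mathbb{N}\}$. The function $f$ is cyclic for $\mathcal{D}(\mathbb{T})$ if $[f]_{\mathbb{N}}=\mathcal{D}(\mathbb{T})$. The energy of a Borel probability measure $\mu$ on $\mathbb{T}$ is $I(\mu):=\iint_{\mathbb{T}^2}\log\frac1{|\zeta-\zeta'|}\,d\mu(\zeta)\,d\mu(\zeta')=\sum_{n\ge1}|\hat\mu(n)|^2/n$. The logarithmic capacity of a Borel set $E\subset\mathbb{T}$ is $c(E):=1/\inf\{I(\mu):\mu\in\mathcal{P}(E)\}$, where $\mathcal{P}(E)$ is the set of Borel probability measures supported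 on a compact subset of $E$ (so $c(E)=0$ when no $\mu\in\mathcal P(E)$ has finite energy). A property holds quasi-everywhere (q.e.) if it holds outside a set of logarithmic capacity zero. For $f\in\mathcal{D}(\mathbb{T})$, the radial limit of the Poisson integral of $f$ exists q.e. on $\mathbb{T}$ and equals $f$ a.e.; $f$ is identified with this radial limit, hence is defined q.e. on $\mathbb{T}$. Its zero set $\mathcal{Z}(f):=\{\zeta\in\mathbb{T}:f(\zeta)=0\}$ is thus defined up to sets of logarithmic capacity zero. *)

theory Defs
  imports "HOL-Analysis.Analysis" "HOL-Probability.Probability_Measure"
begin

abbreviation circle :: "complex set" where
  "circle \<equiv> sphere 0 1"

definition arclength :: "complex measure" where
  "arclength = distr (restrict_space lborel {0..<2*pi}) (restrict_space borel circle) cis"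

definition fourier_coeff :: "(complex \<Rightarrow> complex) \<Rightarrow> int \<Rightarrow> complex" where
  "fourier_coeff f n = of_real (1 / (2*pi)) * (LINT \<zeta>|arclength. f \<zeta> * cnj \<zeta> powi n)"

text \<open>
  Elements of \<open>L\<^sup>2\<close> and of the harmonic Dirichlet space are represented by Borel functions.
  The values outside the circle are irrelevant, and functions that agree almost everywhere on the
  circle are not identified, so \<open>dirichlet_norm\<close> is only a seminorm on \<open>dirichlet_space\<close>.
\<close>

definition dirichlet_space :: "(complex \<Rightarrow> complex) set" where
  "dirichlet_space = {f \<in> borel_measurable arclength.
     integrable arclength (\<lambda>\<zeta>. (norm (f \<zeta>))\<^sup>2) \<and>
     (\<lambda>n::int. (1 + \<bar>of_int n\<bar>) * (norm (fourier_coeff f n))\<^sup>2 :: real) summable_on UNIV}"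

definition dirichlet_norm :: "(complex \<Rightarrow> complex) \<Rightarrow> real" where
  "dirichlet_norm f =
     sqrt (\<Sum>\<^sub>\<infinity>n::int. (1 + \<bar>of_int n\<bar>) * (norm (fourier_coeff f n))\<^sup>2)"

definition shift_span :: "(complex \<Rightarrow> complex) \<Rightarrow> (complex \<Rightarrow> complex) set" where
  "shift_span f = {\<lambda>\<zeta>. \<Sum>n\<in>N. a n * (\<zeta> ^ n * f \<zeta>) | (a :: nat \<Rightarrow> complex) N. finite N}"

text \<open>The closure of \<open>shift_span f\<close> in the Dirichlet space.\<close>

definition shift_closure :: "(complex \<Rightarrow> complex) \<Rightarrow> (complex \<Rightarrow> complex) set" where
  "shift_closure f = {g \<in> dirichlet_space.
     \<forall>\<epsilon>>0. \<exists>h\<in>shift_span f. dirichlet_norm (\<lambda>\<zeta>. g \<zeta> - h \<zeta>) < \<epsilon>}"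

definition cyclic :: "(complex \<Rightarrow> complex) \<Rightarrow> bool" where
  "cyclic f \<longleftrightarrow> shift_closure f = dirichlet_space"

text \<open>
  The real logarithm of the library has \<open>ln 0 = 0\<close>; here the value at \<open>0\<close> has to be \<open>-\<infinity>\<close>.
\<close>

definition elog :: "real \<Rightarrow> ereal" where
  "elog x = (if x = 0 then -\<infinity> else ereal (ln x))"

text \<open>
  Integral of an extended real function as the difference of the integrals of its positive and
  negative parts (\<open>e2ennreal\<close> sends negative arguments to \<open>0\<close>). It is meaningful when
  one of the two is finite; \<open>\<infinity> - \<infinity>\<close> evaluates to \<open>\<infinity>\<close>.
\<close>

definition ereal_integral :: "'a measure \<Rightarrow> ('a \<Rightarrow> ereal) \<Rightarrow> ereal" where
  "ereal_integral M g =
     enn2ereal (\<integral>\<^sup>+x. e2ennreal (g x) \<partial>M) - enn2ereal (\<integral>\<^sup>+x. e2ennreal (- g x) \<partial>M)"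

definition energy :: "complex measure \<Rightarrow> ereal" where
  "energy \<mu> = ereal_integral (\<mu> \<Otimes>\<^sub>M \<mu>) (\<lambda>(\<zeta>, \<zeta>'). - elog (norm (\<zeta> - \<zeta>')))"

definition prob_measures_on :: "complex set \<Rightarrow> complex measure set" where
  "prob_measures_on E = {\<mu>. prob_space \<mu> \<and> sets \<mu> = sets (restrict_space borel circle) \<and>
     (\<exists>K. compact K \<and> K \<subseteq> E \<inter> circle \<and> emeasure \<mu> (circle - K) = 0)}"

text \<open>
  In \<^typ>\<open>ereal\<close> the infimum of the empty set is \<open>\<infinity>\<close>, \<open>1 / \<infinity> = 0\<close> and \<open>1 / 0 = \<infinity>\<close>.
\<close>

definition log_capacity :: "complex set \<Rightarrow> ereal" where
  "log_capacity E = 1 / (INF \<mu>\<in>prob_measures_on E. energy \<mu>)"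

definition poisson_integral :: "(complex \<Rightarrow> complex) \<Rightarrow> complex \<Rightarrow> complex" where
  "poisson_integral f z = of_real (1 / (2*pi)) *
     (LINT \<zeta>|arclength. of_real ((1 - (norm z)\<^sup>2) / (norm (\<zeta> - z))\<^sup>2) * f \<zeta>)"

text \<open>
  The zero set refers to the quasi-everywhere defined radial limit of the Poisson integral and
  not to the values of the representative \<open>f\<close>; points without a radial limit are not included.
\<close>

definition zero_set :: "(complex \<Rightarrow> complex) \<Rightarrow> complex set" where
  "zero_set f = {\<zeta> \<in> circle.
     ((\<lambda>r::real. poisson_integral f (of_real r * \<zeta>)) \<longlongrightarrow> 0) (at_left 1)}"

end

theory Submission
  imports Defs "HOL-Computational_Algebra.Fundamental_Theorem_Algebra" "HOL-Real_Asymp.Real_Asymp"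
begin

text \<open>Two mismatches shape the proof. First, the Dirichlet norm is built from Fourier
  coefficients, while the lower bound of the first half concerns an integral. Carrying it over
  requires that the coefficients dominate the integral. This is the completeness half of Parseval's
  identity and not Bessel's inequality, so trigonometric polynomials have to be shown dense in
  \<open>L\<^sup>2\<close>. Second, a measure of finite energy may be singular, whereas the values
  of a representative matter only up to arclength-null sets. The functional is therefore defined by
  coefficients and not by integrating representatives. Poisson integrals at radius r < 1 link the
  two, since their series converge uniformly on the circle.

  The zero set provides only pointwise convergence of the Poisson integrals, without a common bound.
  Cutting \<mu> down to a set of uniform boundedness takes the place of a maximal inequality. Finite
  energy survives this because the logarithmic kernel is bounded below on the circle, so only its
  positive part matters.

  The test function \<open>\<zeta>\<^sup>-\<^sup>1 f\<close> is chosen because every error then has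
  squared modulus \<open>|q|\<^sup>2 |f|\<^sup>2\<close>, which turns the approximation into a
  problem for the weight \<open>|f|\<^sup>2\<close>.\<close>

text \<open>
  Suppose that \<open>log |f|\<close> is integrable. A function in the span of the \<open>\<zeta>\<^sup>n f\<close> with \<open>n \<ge> 0\<close>
  differs from \<open>\<zeta>\<^sup>-\<^sup>1 f\<close> by \<open>\<zeta>\<^sup>-\<^sup>1 q f\<close> with a polynomial \<open>q\<close> such that \<open>q(0) = 1\<close>. Jensen's
  inequality \<open>\<integral> log |q| \<ge> 0\<close> and the inequality of arithmetic and geometric means bound the
  \<open>L\<^sup>2\<close> norm of this difference from below, so \<open>\<zeta>\<^sup>-\<^sup>1 f\<close> is not in the closure of the span.

  Suppose that a probability measure \<open>\<mu>\<close> of finite energy lives on a compact subset of the zero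
  set. For a sequence \<open>r \<rightarrow> 1\<close> the functions \<open>\<zeta> \<mapsto> P f(r \<zeta>)\<close> are uniformly bounded on a set of
  positive measure \<open>\<mu>\<close>. The restriction \<open>\<nu>\<close> of \<open>\<mu>\<close> to this set still has finite energy, hence
  moments \<open>m(n) = \<integral> \<zeta>\<^sup>n d\<nu>\<close> with \<open>\<Sum> |m(n)|\<^sup>2 / (1 + |n|) < \<infinity>\<close>, and \<open>g \<mapsto> \<Sum> g^(n) m(n)\<close> is a bounded
  functional on the Dirichlet space. By dominated convergence it vanishes at \<open>\<zeta>\<^sup>k f\<close>, as the limit of
  \<open>\<integral> \<zeta>\<^sup>k P f(r \<zeta>) d\<nu>\<close>, but its value at \<open>1\<close> is the mass of \<open>\<nu>\<close>.
\<close>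

subsection \<open>Measures on the circle\<close>

text \<open>Finite measures and not just probability measures are allowed, in order to cover
  arclength, the measure \<mu> on the zero set and its restriction \<nu> alike.\<close>

locale circle_measure = finite_measure M for M :: "complex measure" +
  assumes sets_eq: "sets M = sets (restrict_space borel circle)"
begin

lemma space_eq: "space M = circle"
  using sets_eq_imp_space_eq[OF sets_eq] by (simp add: space_restrict_space)

lemma measurable_circle: "g \<in> borel_measurable borel \<Longrightarrow> g \<in> borel_measurable M"
  using measurable_cong_sets[OF sets_eq refl] measurable_restrict_space1 by blast

lemma integrable_bounded_circle:
  fixes g :: "complex \<Rightarrow> 'b::{banach, second_countable_topology}"
  assumes "g \<in> borel_measurable M" "\<And>z. z \<in> circle \<Longrightarrow> norm (g z) \<le> B"
  shows "integrable M g"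
  by (rule integrable_const_bound[of _ B]) (use assms space_eq in auto)

end

lemma borel_measurable_powi [measurable]:
  "(\<lambda>z::complex. z powi n) \<in> borel_measurable borel"
  unfolding power_int_def by (cases "n \<ge> 0") auto

lemma norm_powi_circle: "z \<in> circle \<Longrightarrow> norm (z powi n) = 1"
  by (simp add: norm_power_int)

lemma mult_cnj_circle: "z \<in> circle \<Longrightarrow> z * cnj z = 1"
  by (simp add: complex_norm_square[symmetric])

lemma cnj_circle: "z \<in> circle \<Longrightarrow> cnj z = inverse z"
  using inverse_unique[OF mult_cnj_circle] by simp

lemma cnj_powi_circle: "z \<in> circle \<Longrightarrow> cnj z powi n = z powi (- n)"
  by (simp add: cnj_circle power_int_minus power_int_inverse)

lemma space_arclength: "space arclength = circle"
  and sets_arclength: "sets arclength = sets (restrict_space borel circle)"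
  by (auto simp: arclength_def space_restrict_space)

lemma measurable_cis_arclength:
  "cis \<in> measurable (restrict_space lborel {0..<2*pi}) (restrict_space borel circle)"
  by (intro measurable_restrict_space2 measurable_restrict_space1)
     (auto intro!: borel_measurable_continuous_onI continuous_intros)

lemma emeasure_arclength: "emeasure arclength circle = ennreal (2 * pi)"
proof -
  have "circle \<in> sets (restrict_space borel circle)"
    unfolding sets_restrict_space by (intro image_eqI[of _ _ UNIV]) auto
  then have "emeasure arclength circle =
      emeasure (restrict_space lborel {0..<2*pi}) (cis -` circle \<inter> space (restrict_space lborel {0..<2*pi}))"
    unfolding arclength_def by (rule emeasure_distr[OF measurable_cis_arclength])
  also have "cis -` circle \<inter> space (restrict_space lborel {0..<2*pi}) = {0..<2*pi}"
    by (auto simp: space_restrict_space)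
  also have "emeasure (restrict_space lborel {0..<2*pi}) {0..<2*pi} = ennreal (2 * pi)"
    using pi_ge_zero by (simp add: emeasure_restrict_space)
  finally show ?thesis .
qed

interpretation arclength: circle_measure arclength
  by (intro circle_measure.intro circle_measure_axioms.intro finite_measureI sets_arclength)
    (simp add: space_arclength emeasure_arclength)

lemma integral_powi_arclength: "(LINT z|arclength. z powi n) = (if n = 0 then 2 * pi else 0)"
proof (cases "n = 0")
  case True
  then show ?thesis using emeasure_arclength by (simp add: space_arclength measure_def scaleR_conv_of_real)
next
  case False
  let ?g = "\<lambda>t. cis (of_int n * t)"
  have "(LINT z|arclength. z powi n) = (LINT t|restrict_space lborel {0..<2*pi}. cis t powi n)"
    unfolding arclength_def
    by (rule integral_distr[OF measurable_cis_arclength]) (intro measurable_restrict_space1 borel_measurable_powi)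
  also have "\<dots> = (LINT t:{0..<2*pi}|lborel. ?g t)"
    by (subst integral_restrict_space) (auto simp: set_lebesgue_integral_def cis_power_int)
  also have "\<dots> = (LINT t:{0..2*pi}|lborel. ?g t)"
  proof (rule set_integral_cong_set[symmetric])
    have [measurable]: "?g \<in> borel_measurable borel"
      by (intro borel_measurable_continuous_onI continuous_intros)
    show "set_borel_measurable lborel {0..<2*pi} ?g" "set_borel_measurable lborel {0..2*pi} ?g"
      unfolding set_borel_measurable_def by measurable
    show "AE x in lborel. (x \<in> {0..<2*pi}) = (x \<in> {0..2*pi})"
      by (rule AE_mp[OF AE_lborel_singleton[of "2*pi"]]) auto
  qed
  also have "\<dots> = (LBINT t=ereal 0..ereal (2*pi). ?g t)"
    by (rule interval_integral_Icc[symmetric]) simp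
  also have "\<dots> = cis (of_int n * (2*pi)) / (\<i> * of_int n) - cis (of_int n * 0) / (\<i> * of_int n)"
  proof -
    have "((\<lambda>t. cis (of_int n * t) / (\<i> * of_int n)) has_vector_derivative ?g t) (at t within S)" for t :: real and S
    proof -
      have "((\<lambda>z. exp (\<i> * (of_int n * z)) / (\<i> * of_int n)) has_field_derivative exp (\<i> * (of_int n * of_real t)))
          (at (of_real t))"
        using False by (auto intro!: derivative_eq_intros simp: field_simps)
      from has_vector_derivative_real_field[OF this, of S] show ?thesis by (simp add: cis_conv_exp)
    qed
    then show ?thesis
      by (intro interval_integral_FTC_finite continuous_intros) simp
  qed
  also have "\<dots> = 0"
  proof -
    have "cis (of_int n * (2*pi)) = 1"
      using cis_multiple_2pi[of "of_int n"] by (simp add: mult.commute)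
    then show ?thesis by simp
  qed
  finally show ?thesis using False by simp
qed

subsection \<open>Sums of integrals\<close>

text \<open>Fubini and dominated convergence are stated for integrals; this makes them applicable to
  the sums over the integers that define the pairing.\<close>

lemma integral_count_space_eq_infsum:
  fixes c :: "'i \<Rightarrow> complex"
  assumes "(\<lambda>n. norm (c n)) summable_on A"
  shows "(\<integral>n. c n \<partial>count_space A) = infsum c A"
  using infsetsum_infsum[of c A] assms abs_summable_equivalent[of c A]
  unfolding infsetsum_def by simp

text \<open>Fubini for the product of counting measure and \<open>M\<close>. The product majorant
  \<open>b n * g x\<close> gives integrability on the product. This form fits the Poisson series as
  well as the logarithmic series, where \<open>b n\<close> is a power of a radius below 1.\<close>

lemma has_sum_integral:
  fixes F :: "'i::countable \<Rightarrow> 'a \<Rightarrow> complex"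
  assumes "sigma_finite_measure M" and F: "\<And>n. F n \<in> borel_measurable M"
    and b: "b summable_on UNIV" "\<And>n. b n \<ge> 0" and g: "integrable M g"
    and le: "\<And>n x. x \<in> space M \<Longrightarrow> norm (F n x) \<le> b n * g x"
    and S: "\<And>x. x \<in> space M \<Longrightarrow> ((\<lambda>n. F n x) has_sum S x) UNIV"
  shows "integrable M S" "((\<lambda>n. \<integral>x. F n x \<partial>M) has_sum (\<integral>x. S x \<partial>M)) UNIV"
    "(\<lambda>n. norm (\<integral>x. F n x \<partial>M)) summable_on UNIV"
proof -
  let ?C = "count_space (UNIV :: 'i set)"
  interpret M: sigma_finite_measure M by fact
  interpret C: sigma_finite_measure ?C by (rule sigma_finite_measure_count_space_countable) auto
  interpret pair_sigma_finite ?C M ..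
  have meas: "case_prod F \<in> borel_measurable (?C \<Otimes>\<^sub>M M)"
    using F by (intro measurable_pair_measure_countable1) auto
  have bi: "integrable ?C b"
    using b abs_summable_equivalent[of b UNIV] by (simp add: abs_summable_on_def)
  have Fi: "integrable M (F n)" for n
  proof (rule Bochner_Integration.integrable_bound)
    show "integrable M (\<lambda>x. b n * g x)" using g by simp
    show "AE x in M. norm (F n x) \<le> norm (b n * g x)"
      using le by (intro AE_I2) (simp add: order_trans[OF _ abs_ge_self])
  qed (use F in auto)
  have nF: "(\<integral>x. norm (F n x) \<partial>M) \<le> b n * (\<integral>x. g x \<partial>M)" for n
  proof -
    have "(\<integral>x. norm (F n x) \<partial>M) \<le> (\<integral>x. b n * g x \<partial>M)"
      using le g Fi by (intro integral_mono) auto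
    then show ?thesis using g by simp
  qed
  have nFi: "integrable ?C (\<lambda>n. \<integral>x. norm (F n x) \<partial>M)"
  proof (rule Bochner_Integration.integrable_bound)
    show "integrable ?C (\<lambda>n. b n * (\<integral>x. g x \<partial>M))" using bi by simp
    show "AE n in ?C. norm (\<integral>x. norm (F n x) \<partial>M) \<le> norm (b n * (\<integral>x. g x \<partial>M))"
      using nF by (auto intro!: AE_I2 order_trans[OF nF])
  qed auto
  have int: "integrable (?C \<Otimes>\<^sub>M M) (case_prod F)"
    using meas nFi Fi by (intro Fubini_integrable) auto
  have sumi: "integrable ?C (\<lambda>n. \<integral>x. F n x \<partial>M)"
    using integrable_fst[OF int] by simp
  have ab: "(\<lambda>n. norm (\<integral>x. F n x \<partial>M)) summable_on UNIV"
    using sumi abs_summable_equivalent[of "\<lambda>n. \<integral>x. F n x \<partial>M" UNIV] by (simp add: abs_summable_on_def)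
  show "(\<lambda>n. norm (\<integral>x. F n x \<partial>M)) summable_on UNIV" by (rule ab)
  have eqS: "(\<integral>n. F n x \<partial>?C) = S x" if "x \<in> space M" for x
  proof -
    have "(\<lambda>n. norm (F n x)) summable_on UNIV"
    proof (rule summable_on_comparison_test)
      show "(\<lambda>n. b n * g x) summable_on UNIV" using b(1) by (rule summable_on_cmult_left)
    qed (use le that in auto)
    from integral_count_space_eq_infsum[OF this] show ?thesis using infsumI[OF S[OF that]] by simp
  qed
  have "integrable M (\<lambda>x. \<integral>n. F n x \<partial>?C)"
    using integrable_snd[OF int] .
  then show "integrable M S"
    using eqS by (subst Bochner_Integration.integrable_cong[OF refl, of _ _ "\<lambda>x. \<integral>n. F n x \<partial>?C"]) auto
  have "(\<integral>x. S x \<partial>M) = (\<integral>x. (\<integral>n. F n x \<partial>?C) \<partial>M)"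
    using eqS by (intro Bochner_Integration.integral_cong) auto
  also have "\<dots> = (\<integral>n. (\<integral>x. F n x \<partial>M) \<partial>?C)"
    by (rule Fubini_integral[OF int])
  also have "\<dots> = infsum (\<lambda>n. \<integral>x. F n x \<partial>M) UNIV"
    by (rule integral_count_space_eq_infsum[OF ab])
  finally show "((\<lambda>n. \<integral>x. F n x \<partial>M) has_sum (\<integral>x. S x \<partial>M)) UNIV"
    using abs_summable_summable[OF ab] by (simp add: has_sum_infsum)
qed

lemma has_sum_int_split:
  fixes a :: "int \<Rightarrow> 'a::{topological_comm_monoid_add, t2_space}"
  assumes "((\<lambda>n. a (int n)) has_sum x) UNIV" "((\<lambda>n. a (- int (Suc n))) has_sum y) UNIV"
  shows "(a has_sum (x + y)) UNIV"
proof -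
  have "(a has_sum x) (range int)"
    using assms(1) by (subst has_sum_reindex) (auto simp: o_def)
  moreover have "(a has_sum y) (range (\<lambda>n. - int (Suc n)))"
    using assms(2) by (subst has_sum_reindex) (auto simp: o_def inj_on_def)
  moreover have "range int \<inter> range (\<lambda>n. - int (Suc n)) = {}" by auto
  ultimately have "(a has_sum (x + y)) (range int \<union> range (\<lambda>n. - int (Suc n)))"
    by (rule has_sum_Un_disjoint)
  moreover have "range int \<union> range (\<lambda>n. - int (Suc n)) = UNIV"
  proof -
    have "k \<in> range int \<union> range (\<lambda>n. - int (Suc n))" for k :: int
      by (cases k) (auto simp del: of_nat_Suc)
    then show ?thesis by blast
  qed
  ultimately show ?thesis by simp
qed

section \<open>Expansion of the Poisson kernel\<close>

lemma summable_on_power_abs: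
  fixes r :: real
  assumes "0 \<le> r" "r < 1"
  shows "(\<lambda>n::int. r ^ nat \<bar>n\<bar>) summable_on UNIV"
proof -
  have "((\<lambda>n. r ^ n) has_sum (1 / (1 - r))) UNIV"
    using assms by (intro norm_summable_imp_has_sum) (auto simp: power_abs abs_of_nonneg intro: geometric_sums)
  moreover from has_sum_cmult_right[OF this, of r]
  have "((\<lambda>n. r ^ nat \<bar>- int (Suc n)\<bar>) has_sum (r * (1 / (1 - r)))) UNIV"
    by (simp add: nat_add_distrib)
  ultimately show ?thesis
    using has_sum_int_split[of "\<lambda>n. r ^ nat \<bar>n\<bar>"] by (auto simp: summable_on_def)
qed

text \<open>With \<open>a = r * (z * cnj w)\<close> the indices n >= 0 contribute the geometric
  series of \<open>a\<close>, and the negative ones that of \<open>cnj a\<close> without its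
  constant term, because inversion is conjugation on the circle. Their sum is
  \<open>(1 - |a|\<^sup>2) / |1 - a|\<^sup>2\<close>, and
  \<open>|1 - a| = |w - r z|\<close>.\<close>

lemma poisson_kernel_has_sum:
  assumes "0 \<le> r" "r < 1" "z \<in> circle" "w \<in> circle"
  shows "((\<lambda>n::int. of_real (r ^ nat \<bar>n\<bar>) * (z powi n * cnj w powi n)) has_sum
     of_real ((1 - (norm (of_real r * z))\<^sup>2) / (norm (w - of_real r * z))\<^sup>2)) UNIV"
proof -
  define a where "a = of_real r * (z * cnj w)"
  have nz: "norm z = 1" "norm w = 1" using assms by auto
  then have na: "norm a = r" using assms(1) by (simp add: a_def norm_mult)
  have geo: "((\<lambda>n. c ^ n) has_sum (1 / (1 - c))) UNIV" if "norm c < 1" for c :: complex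
    using that by (intro norm_summable_imp_has_sum) (auto simp: norm_power intro: geometric_sums)
  have inv: "inverse (z * cnj w) = cnj (z * cnj w)"
    using nz by (intro cnj_circle[symmetric]) (simp add: norm_mult)
  have 1: "((\<lambda>n. of_real (r ^ nat \<bar>int n\<bar>) * (z powi int n * cnj w powi int n)) has_sum (1 / (1 - a))) UNIV"
    using geo[of a] na assms(2) by (simp add: a_def power_mult_distrib)
  have "of_real (r ^ nat \<bar>- int (Suc n)\<bar>) * (z powi (- int (Suc n)) * cnj w powi (- int (Suc n)))
      = cnj a * cnj a ^ n" for n
  proof -
    have "z powi (- int (Suc n)) * cnj w powi (- int (Suc n)) = inverse (z * cnj w) ^ Suc n"
      by (simp only: power_int_minus power_int_of_nat power_inverse power_mult_distrib inverse_mult_distrib)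
    then show ?thesis unfolding inv
      by (simp add: a_def power_mult_distrib nat_add_distrib del: of_nat_Suc)
  qed
  then have 2: "((\<lambda>n. of_real (r ^ nat \<bar>- int (Suc n)\<bar>) * (z powi (- int (Suc n)) * cnj w powi (- int (Suc n)))) has_sum
      (cnj a * (1 / (1 - cnj a)))) UNIV"
    using has_sum_cmult_right[OF geo[of "cnj a"], of "cnj a"] na assms(2) by simp
  have "a \<noteq> 1" using na assms by auto
  then have "1 - a \<noteq> 0" "1 - cnj a \<noteq> 0" by (auto simp: complex_eq_iff)
  then have "1 / (1 - a) + cnj a * (1 / (1 - cnj a)) = (1 - a * cnj a) / ((1 - a) * cnj (1 - a))"
    by (simp add: field_simps)
  also have "\<dots> = of_real ((1 - (norm a)\<^sup>2) / (norm (1 - a))\<^sup>2)"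
    using complex_norm_square[of a] complex_norm_square[of "1 - a"] by simp
  also have "norm a = norm (of_real r * z)" using nz by (simp add: a_def norm_mult)
  also have "norm (1 - a) = norm (w - of_real r * z)"
  proof -
    have "w - of_real r * z = w * (1 - a)"
    proof -
      have "w * (1 - a) = w - of_real r * (w * cnj w) * z" by (simp add: a_def algebra_simps)
      then show ?thesis using mult_cnj_circle[OF assms(4)] by simp
    qed
    then show ?thesis using nz(2) by (simp add: norm_mult)
  qed
  finally show ?thesis using has_sum_int_split[OF 1 2] by simp
qed

subsection \<open>Fourier coefficients\<close>

lemma integrable_of_square_integrable:
  fixes f :: "complex \<Rightarrow> complex"
  assumes "f \<in> borel_measurable arclength" "integrable arclength (\<lambda>z. (norm (f z))\<^sup>2)"
  shows "integrable arclength f"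
proof (rule Bochner_Integration.integrable_bound)
  show "integrable arclength (\<lambda>z. 1 + (norm (f z))\<^sup>2)" using assms(2) by auto
  have "x \<le> 1 + x\<^sup>2" for x :: real
    using zero_le_power2[of "x - 1/2"] by (simp add: power2_eq_square algebra_simps)
  then show "AE z in arclength. norm (f z) \<le> norm (1 + (norm (f z))\<^sup>2)" by simp
qed fact

lemma integrable_mult_circle:
  fixes f :: "complex \<Rightarrow> complex"
  assumes "integrable arclength f" "g \<in> borel_measurable borel" "\<And>z. z \<in> circle \<Longrightarrow> norm (g z) \<le> C"
  shows "integrable arclength (\<lambda>z. f z * g z)"
proof (rule Bochner_Integration.integrable_bound)
  show "integrable arclength (\<lambda>z. C * norm (f z))" using assms(1) by auto
  show "(\<lambda>z. f z * g z) \<in> borel_measurable arclength"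
    using assms arclength.measurable_circle[OF assms(2)] by measurable
  show "AE z in arclength. norm (f z * g z) \<le> norm (C * norm (f z))"
  proof (intro AE_I2)
    fix z assume "z \<in> space arclength"
    then have "norm (g z) * norm (f z) \<le> C * norm (f z)"
      using assms(3) by (intro mult_right_mono) (auto simp: space_arclength)
    then show "norm (f z * g z) \<le> norm (C * norm (f z))"
      by (simp add: norm_mult mult.commute)
  qed
qed

lemma fourier_coeff_powi: "fourier_coeff f n = of_real (1 / (2*pi)) * (LINT z|arclength. f z * z powi (- n))"
  unfolding fourier_coeff_def
  by (intro arg_cong2[where f="(*)"] refl Bochner_Integration.integral_cong)
    (auto simp: space_arclength cnj_powi_circle)

lemma integrable_mult_powi:
  "integrable arclength f \<Longrightarrow> integrable arclength (\<lambda>z. f z * z powi n)"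
  by (rule integrable_mult_circle[where C = 1]) (auto simp: norm_powi_circle)

lemma fourier_coeff_linear:
  assumes "integrable arclength f" "integrable arclength g"
  shows "fourier_coeff (\<lambda>z. a * f z + b * g z) n = a * fourier_coeff f n + b * fourier_coeff g n"
proof -
  have "(LINT z|arclength. (a * f z + b * g z) * z powi (- n))
    = (LINT z|arclength. a * (f z * z powi (- n)) + b * (g z * z powi (- n)))"
    by (simp add: algebra_simps)
  also have "\<dots> = a * (LINT z|arclength. f z * z powi (- n)) + b * (LINT z|arclength. g z * z powi (- n))"
    using assms by (subst Bochner_Integration.integral_add) (auto intro!: integrable_mult_powi integrable_mult_right)
  finally show ?thesis by (simp add: fourier_coeff_powi algebra_simps)
qed

lemma fourier_coeff_shift: "fourier_coeff (\<lambda>z. z powi k * f z) n = fourier_coeff f (n - k)"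
proof -
  have "(LINT z|arclength. z powi k * f z * z powi (- n)) = (LINT z|arclength. f z * z powi (- (n - k)))"
  proof (intro Bochner_Integration.integral_cong refl)
    fix z assume "z \<in> space arclength"
    then have "z \<noteq> 0" by (auto simp: space_arclength)
    then have "z powi k * z powi (- n) = z powi (- (n - k))"
      by (simp add: power_int_add[symmetric])
    then show "z powi k * f z * z powi (- n) = f z * z powi (- (n - k))" by (simp add: ac_simps)
  qed
  then show ?thesis by (simp add: fourier_coeff_powi)
qed

lemma fourier_coeff_one: "fourier_coeff (\<lambda>_. 1) n = (if n = 0 then 1 else 0)"
  using integral_powi_arclength[of "- n"] by (simp add: fourier_coeff_powi)

lemma norm_fourier_coeff_le: "norm (fourier_coeff f n) \<le> (LINT z|arclength. norm (f z))"
proof -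
  have "norm (LINT z|arclength. f z * z powi (- n)) \<le> (LINT z|arclength. norm (f z * z powi (- n)))"
    by (rule integral_norm_bound)
  also have "\<dots> = (LINT z|arclength. norm (f z))"
    by (intro Bochner_Integration.integral_cong refl) (use norm_powi_circle space_arclength in \<open>auto simp: norm_mult\<close>)
  finally have *: "norm (LINT z|arclength. f z * z powi (- n)) \<le> (LINT z|arclength. norm (f z))" .
  have "norm (fourier_coeff f n) = 1 / (2*pi) * norm (LINT z|arclength. f z * z powi (- n))"
    by (simp add: fourier_coeff_powi norm_mult norm_divide)
  also have "\<dots> \<le> 1 * norm (LINT z|arclength. f z * z powi (- n))"
    using pi_gt3 by (intro mult_right_mono) auto
  finally show ?thesis using * by linarith
qed

text \<open>The kernel expansion is integrated termwise against \<open>f\<close>, with majorant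
  \<open>r ^ |n| * |f|\<close>. This is what connects the radial limits in \<open>zero_set\<close>
  with Fourier coefficients.\<close>

lemma poisson_integral_has_sum:
  assumes f: "integrable arclength f" and "0 \<le> r" "r < 1" "z \<in> circle"
  shows "((\<lambda>n. of_real (r ^ nat \<bar>n\<bar>) * fourier_coeff f n * z powi n) has_sum poisson_integral f (of_real r * z)) UNIV"
proof -
  let ?F = "\<lambda>n w. of_real (r ^ nat \<bar>n\<bar>) * (z powi n * cnj w powi n) * f w"
  let ?S = "\<lambda>w. of_real ((1 - (norm (of_real r * z))\<^sup>2) / (norm (w - of_real r * z))\<^sup>2) * f w"
  have "((\<lambda>n. LINT w|arclength. ?F n w) has_sum (LINT w|arclength. ?S w)) UNIV"
  proof (rule has_sum_integral(2)[where b = "\<lambda>n. r ^ nat \<bar>n\<bar>" and g = "\<lambda>w. norm (f w)"])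
    show "sigma_finite_measure arclength" by unfold_locales
    show "?F n \<in> borel_measurable arclength" for n
    proof -
      have "(\<lambda>w. cnj w powi n) \<in> borel_measurable borel"
        by (rule measurable_compose[OF _ borel_measurable_powi]) (auto intro!: borel_measurable_continuous_onI continuous_intros)
      from arclength.measurable_circle[OF this] show ?thesis using f by measurable
    qed
    show "norm (?F n w) \<le> r ^ nat \<bar>n\<bar> * norm (f w)" if "w \<in> space arclength" for n w
      using that assms norm_powi_circle[of w n] norm_powi_circle[of z n]
      by (simp add: space_arclength norm_mult norm_power norm_power_int)
    show "((\<lambda>n. ?F n w) has_sum ?S w) UNIV" if "w \<in> space arclength" for w
      using that assms by (intro has_sum_cmult_left poisson_kernel_has_sum) (auto simp: space_arclength)
  qed (use assms f in \<open>auto intro: summable_on_power_abs\<close>)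
  from has_sum_cmult_right[OF this, of "of_real (1 / (2*pi))"] show ?thesis
    unfolding poisson_integral_def
    by (rule has_sum_cong[THEN iffD1, rotated])
      (simp add: fourier_coeff_def ac_simps flip: integral_mult_right_zero)
qed

subsection \<open>Moments of measures of finite energy\<close>

text \<open>This is the Fourier coefficient of the measure at \<open>- n\<close>, without the factor
  1/(2 pi). The sign is such that the sum of \<open>fourier_coeff g n * moment M n\<close> is
  formally the integral of g.\<close>

definition moment :: "complex measure \<Rightarrow> int \<Rightarrow> complex" where
  "moment M n = (LINT z|M. z powi n)"

context circle_measure
begin

lemma measurable_powi: "(\<lambda>z. z powi n) \<in> borel_measurable M"
  by (intro measurable_circle borel_measurable_powi)

lemma moment_minus: "moment M (- n) = cnj (moment M n)"
proof -
  have "moment M (- n) = (LINT z|M. cnj (z powi n))"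
    unfolding moment_def
    by (intro Bochner_Integration.integral_cong refl) (simp add: space_eq cnj_powi_circle)
  also have "\<dots> = cnj (moment M n)" unfolding moment_def by (rule Bochner_Integration.integral_cnj)
  finally show ?thesis .
qed

end

lemma measurable_elog [measurable]: "elog \<in> borel_measurable borel"
  unfolding elog_def by measurable

text \<open>For \<open>a = x * cnj y\<close> of modulus 1 both \<open>1 - r\<close> and
  \<open>|1 - a| - (1 - r)\<close> are at most \<open>|1 - r a|\<close>, so
  \<open>|x - y| = |1 - a|\<close> is at most \<open>2 * |1 - r a|\<close>. The bound is uniform in
  r, which allows the limit r \<rightarrow> 1 in \<open>summable_moments\<close>. On the diagonal
  the right-hand side is infinite.\<close>

lemma log_kernel_le:
  assumes "x \<in> circle" "y \<in> circle" "0 < r" "r < 1"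
  shows "ennreal (- ln (norm (1 - of_real r * (x * cnj y)))) \<le>
    ennreal (ln 2) + e2ennreal (- elog (norm (x - y)))"
proof (cases "x = y")
  case True
  then show ?thesis by (simp add: elog_def)
next
  case False
  define a where "a = x * cnj y"
  have na: "norm a = 1" using assms by (simp add: a_def norm_mult)
  have "norm (1 - a) = norm (x - y)"
  proof -
    have "x - y = - (y * (1 - a))"
      using mult_cnj_circle[OF assms(2)] by (simp add: a_def algebra_simps)
    then show ?thesis using assms(2) by (simp add: norm_mult)
  qed
  have "1 - r \<le> norm (1 - of_real r * a)"
    using norm_triangle_ineq2[of 1 "of_real r * a"] assms na by (simp add: norm_mult)
  moreover have "norm (1 - a) \<le> norm (1 - of_real r * a) + norm (of_real (1 - r) * a)"
    using norm_triangle_ineq4[of "1 - of_real r * a" "of_real (1 - r) * a"] by (simp add: algebra_simps)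
  ultimately have "norm (x - y) \<le> 2 * norm (1 - of_real r * a)"
    using \<open>norm (1 - a) = norm (x - y)\<close> na assms by (simp add: norm_mult del: of_real_diff)
  moreover have pos: "0 < norm (x - y)" using False by simp
  ultimately have "ln (norm (x - y)) \<le> ln (2 * norm (1 - of_real r * a))"
    by (intro ln_mono) auto
  also have "\<dots> = ln 2 + ln (norm (1 - of_real r * a))"
    using \<open>norm (x - y) \<le> 2 * norm (1 - of_real r * a)\<close> pos by (intro ln_mult_pos) auto
  finally have "- ln (norm (1 - of_real r * a)) \<le> ln 2 + - ln (norm (x - y))" by simp
  then have "ennreal (- ln (norm (1 - of_real r * a))) \<le> ennreal (ln 2 + max 0 (- ln (norm (x - y))))"
    by (intro ennreal_leI) auto
  also have "\<dots> = ennreal (ln 2) + ennreal (- ln (norm (x - y)))"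
    by (subst ennreal_plus) (auto simp: max_def ennreal_neg)
  finally show ?thesis
    using pos by (simp add: elog_def a_def)
qed

lemma divide_nat_le: "0 \<le> x \<Longrightarrow> x / real n \<le> x"
  by (cases "n = 0") (auto simp: divide_le_eq mult_le_cancel_left1)

text \<open>The term at n = 0 is 0 because division by zero gives 0, so this is the usual series
  starting at n = 1.\<close>

lemma log_series_has_sum:
  assumes "norm a < 1"
  shows "((\<lambda>n::nat. a ^ n / of_nat n) has_sum (- Ln (1 - a))) UNIV"
proof -
  have "(\<lambda>n. a ^ n / of_nat n) sums (- Ln (1 - a))"
    using sums_minus[OF Ln_series'[of "- a"]] assms by simp
  moreover have "summable (\<lambda>n. norm (a ^ n / of_nat n))"
  proof (rule summable_comparison_test')
    show "summable (\<lambda>n. norm a ^ n)" using assms by simp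
    show "norm (norm (a ^ n / of_nat n)) \<le> norm a ^ n" if "n \<ge> 0" for n :: nat
      by (simp add: norm_divide norm_power divide_nat_le)
  qed
  ultimately show ?thesis by (rule norm_summable_imp_has_sum[rotated])
qed

text \<open>For r < 1 the kernel \<open>- ln |1 - r x (cnj y)|\<close> is the real part of a
  uniformly convergent power series. Its double integral is the sum of
  \<open>r ^ n / n * |moment M n|\<^sup>2\<close>. By \<open>log_kernel_le\<close> the positive part
  of the logarithmic kernel bounds it independently of r. Each finite partial sum passes to the
  limit r \<rightarrow> 1, and the terms are nonnegative.\<close>

lemma (in circle_measure) summable_moments:
  assumes C: "(\<integral>\<^sup>+p. e2ennreal (- elog (norm (fst p - snd p))) \<partial>(M \<Otimes>\<^sub>M M)) < \<infinity>"
  shows "(\<lambda>n::int. (norm (moment M n))\<^sup>2 / (1 + \<bar>of_int n\<bar>)) summable_on UNIV"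
proof -
  interpret P: pair_sigma_finite M M ..
  interpret PM: finite_measure "M \<Otimes>\<^sub>M M"
    by (intro finite_measure_pair_measure) unfold_locales
  \<comment> \<open>The common bound for all r: log 2 times the squared total mass, plus the
    integral of the positive part of the kernel.\<close>
  define B where "B = enn2real ((\<integral>\<^sup>+p. ennreal (ln 2) + e2ennreal (- elog (norm (fst p - snd p))) \<partial>(M \<Otimes>\<^sub>M M)))"
  have [measurable]: "(\<lambda>z. z) \<in> borel_measurable M" "cnj \<in> borel_measurable M"
    by (auto intro!: measurable_circle borel_measurable_continuous_onI continuous_intros)
  have [measurable]: "cnj \<in> borel_measurable borel"
    by (auto intro!: borel_measurable_continuous_onI continuous_intros)
  have [measurable]: "fst \<in> borel_measurable (M \<Otimes>\<^sub>M M)" "snd \<in> borel_measurable (M \<Otimes>\<^sub>M M)"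
    using measurable_compose[OF measurable_fst, of "\<lambda>z. z" M borel M] measurable_compose[OF measurable_snd, of "\<lambda>z. z" M borel M]
    by (auto simp: measurable_circle)
  have "(\<integral>\<^sup>+p. ennreal (ln 2) + e2ennreal (- elog (norm (fst p - snd p))) \<partial>(M \<Otimes>\<^sub>M M))
     = (\<integral>\<^sup>+p. ennreal (ln 2) \<partial>(M \<Otimes>\<^sub>M M)) + (\<integral>\<^sup>+p. e2ennreal (- elog (norm (fst p - snd p))) \<partial>(M \<Otimes>\<^sub>M M))"
    by (rule nn_integral_add) auto
  also have "\<dots> < \<infinity>" using C PM.emeasure_finite by (simp add: ennreal_mult_eq_top_iff less_top[symmetric])
  finally have B: "(\<integral>\<^sup>+p. ennreal (ln 2) + e2ennreal (- elog (norm (fst p - snd p))) \<partial>(M \<Otimes>\<^sub>M M)) = ennreal B"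
    by (simp add: B_def less_top)
  have main: "(\<Sum>n\<le>N. r ^ n / n * (norm (moment M (int n)))\<^sup>2) \<le> B" if r: "0 < r" "r < 1" for r :: real and N
  proof -
    let ?F = "\<lambda>n p. (of_real r * (fst p * cnj (snd p))) ^ n / of_nat n"
    let ?S = "\<lambda>p. - Ln (1 - of_real r * (fst p * cnj (snd p)))"
    have sp: "norm (of_real r * (fst p * cnj (snd p))) = r" if "p \<in> space (M \<Otimes>\<^sub>M M)" for p
      using that r by (auto simp: space_pair_measure space_eq norm_mult)
    have bound: "norm (?F n p) \<le> r ^ n * 1" if "p \<in> space (M \<Otimes>\<^sub>M M)" for n p
    proof -
      have "r ^ n / n \<le> r ^ n"
        using r by (intro divide_nat_le) simp
      then show ?thesis using sp[OF that] by (simp add: norm_divide norm_power del: norm_mult)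
    qed
    have meas: "?F n \<in> borel_measurable (M \<Otimes>\<^sub>M M)" for n by measurable
    have *: "integrable (M \<Otimes>\<^sub>M M) ?S" "((\<lambda>n. \<integral>p. ?F n p \<partial>(M \<Otimes>\<^sub>M M)) has_sum (\<integral>p. ?S p \<partial>(M \<Otimes>\<^sub>M M))) UNIV"
    proof -
      have "sigma_finite_measure (M \<Otimes>\<^sub>M M)" by unfold_locales
      moreover have "(\<lambda>n. r ^ n) summable_on UNIV"
        using r by (intro norm_summable_imp_summable_on) (auto simp: power_abs)
      moreover have "((\<lambda>n. ?F n p) has_sum ?S p) UNIV" if "p \<in> space (M \<Otimes>\<^sub>M M)" for p
        using sp[OF that] r by (intro log_series_has_sum) auto
      moreover have "integrable (M \<Otimes>\<^sub>M M) (\<lambda>_. 1::real)" by simp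
      ultimately show "integrable (M \<Otimes>\<^sub>M M) ?S" "((\<lambda>n. \<integral>p. ?F n p \<partial>(M \<Otimes>\<^sub>M M)) has_sum (\<integral>p. ?S p \<partial>(M \<Otimes>\<^sub>M M))) UNIV"
        using has_sum_integral[of "M \<Otimes>\<^sub>M M" ?F "\<lambda>n. r ^ n" "\<lambda>_. 1" ?S] meas bound r by auto
    qed
    \<comment> \<open>The integrand separates into a function of x and the conjugate of the same
      function of y, so the double integral is a squared modulus.\<close>
    have F: "(\<integral>p. ?F n p \<partial>(M \<Otimes>\<^sub>M M)) = of_real (r ^ n / n * (norm (moment M (int n)))\<^sup>2)" for n
    proof -
      have "integrable (M \<Otimes>\<^sub>M M) (?F n)"
        using bound meas by (intro PM.integrable_const_bound[of _ "r ^ n"]) auto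
      then have "(\<integral>p. ?F n p \<partial>(M \<Otimes>\<^sub>M M)) = (\<integral>x. \<integral>y. ?F n (x, y) \<partial>M \<partial>M)"
        by (rule P.integral_fst'[symmetric])
      also have "\<dots> = (\<integral>x. x ^ n * (of_real (r ^ n / n) * cnj (moment M (int n))) \<partial>M)"
      proof (intro Bochner_Integration.integral_cong refl)
        fix x
        have "(\<integral>y. ?F n (x, y) \<partial>M) = (\<integral>y. (of_real (r ^ n / n) * x ^ n) * cnj (y ^ n) \<partial>M)"
          by (simp add: power_mult_distrib field_simps)
        also have "\<dots> = (of_real (r ^ n / n) * x ^ n) * cnj (\<integral>y. y ^ n \<partial>M)"
          by (simp only: integral_mult_right_zero Bochner_Integration.integral_cnj)
        finally show "(\<integral>y. ?F n (x, y) \<partial>M) = x ^ n * (of_real (r ^ n / n) * cnj (moment M (int n)))"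
          by (simp add: moment_def ac_simps)
      qed
      also have "\<dots> = moment M (int n) * (of_real (r ^ n / n) * cnj (moment M (int n)))"
        by (simp add: moment_def)
      also have "\<dots> = of_real (r ^ n / n * (norm (moment M (int n)))\<^sup>2)"
        unfolding of_real_mult complex_norm_square by (simp only: ac_simps)
      finally show ?thesis .
    qed
    have "((\<lambda>n. Re (of_real (r ^ n / n * (norm (moment M (int n)))\<^sup>2))) has_sum Re (\<integral>p. ?S p \<partial>(M \<Otimes>\<^sub>M M))) UNIV"
      using has_sum_Re[OF *(2)] unfolding F by simp
    then have hs: "((\<lambda>n. r ^ n / n * (norm (moment M (int n)))\<^sup>2) has_sum Re (\<integral>p. ?S p \<partial>(M \<Otimes>\<^sub>M M))) UNIV"
      unfolding Re_complex_of_real .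
    have "(\<Sum>n\<le>N. r ^ n / n * (norm (moment M (int n)))\<^sup>2) \<le> Re (\<integral>p. ?S p \<partial>(M \<Otimes>\<^sub>M M))"
      using r by (intro finite_sum_le_has_sum[OF hs]) auto
    also have "\<dots> = (\<integral>p. - ln (norm (1 - of_real r * (fst p * cnj (snd p)))) \<partial>(M \<Otimes>\<^sub>M M))"
    proof -
      have "1 - of_real r * (fst p * cnj (snd p)) \<noteq> 0" if "p \<in> space (M \<Otimes>\<^sub>M M)" for p
        using sp[OF that] r by auto
      then have "(\<integral>p. Re (?S p) \<partial>(M \<Otimes>\<^sub>M M)) = (\<integral>p. - ln (norm (1 - of_real r * (fst p * cnj (snd p)))) \<partial>(M \<Otimes>\<^sub>M M))"
        by (intro Bochner_Integration.integral_cong refl) simp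
      then show ?thesis using integral_Re[OF *(1)] by simp
    qed
    also have "\<dots> \<le> B"
    proof (rule integral_real_bounded)
      show "(\<integral>\<^sup>+p. ennreal (- ln (norm (1 - of_real r * (fst p * cnj (snd p))))) \<partial>(M \<Otimes>\<^sub>M M)) \<le> ennreal B"
        unfolding B[symmetric]
        using log_kernel_le r by (intro nn_integral_mono) (auto simp: space_pair_measure space_eq)
    qed (simp add: B_def)
    finally show ?thesis .
  qed
  have bd: "(\<Sum>n\<le>N. (norm (moment M (int n)))\<^sup>2 / n) \<le> B" for N
  proof (rule tendsto_upperbound)
    show "((\<lambda>r. \<Sum>n\<le>N. r ^ n / n * (norm (moment M (int n)))\<^sup>2) \<longlongrightarrow> (\<Sum>n\<le>N. (norm (moment M (int n)))\<^sup>2 / n)) (at_left 1)"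
      unfolding divide_inverse
      by (rule tendsto_eq_rhs, (rule tendsto_sum tendsto_const tendsto_mult tendsto_power tendsto_ident_at)+)
        (simp add: mult.commute)
    show "\<forall>\<^sub>F r in at_left 1. (\<Sum>n\<le>N. r ^ n / n * (norm (moment M (int n)))\<^sup>2) \<le> B"
      by (rule eventually_mono[OF eventually_at_left_real[of 0 1]]) (simp, rule main, auto)
  qed auto
  have "summable (\<lambda>n. (norm (moment M (int n)))\<^sup>2 / n)"
  proof (rule summableI_nonneg_bounded)
    show "(\<Sum>i<n. (norm (moment M (int i)))\<^sup>2 / i) \<le> B" for n
      by (rule order_trans[OF sum_mono2 bd[of n]]) auto
  qed simp
  from summable_Suc_iff[THEN iffD2, OF this]
  have s: "(\<lambda>n. (norm (moment M (int (Suc n))))\<^sup>2 / real (Suc n)) summable_on UNIV"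
    by (intro norm_summable_imp_summable_on) (simp del: of_nat_Suc)
  \<comment> \<open>The weight 1/n says nothing at n = 0. From index 1 on, 1/(1 + n) is at most 1/n;
    the single term at 0 is put back in \<open>s2\<close>, and \<open>moment_minus\<close> covers
    the negative indices.\<close>
  have s1: "(\<lambda>n. (norm (moment M (int (Suc n))))\<^sup>2 / (1 + \<bar>of_int (int (Suc n))\<bar>)) summable_on UNIV"
    by (rule summable_on_comparison_test[OF s]) (auto intro!: divide_left_mono)
  have s2: "(\<lambda>n. (norm (moment M (int n)))\<^sup>2 / (1 + \<bar>of_int (int n)\<bar>)) summable_on UNIV"
  proof -
    let ?h = "\<lambda>n. (norm (moment M (int n)))\<^sup>2 / (1 + \<bar>real_of_int (int n)\<bar>)"
    have "summable (\<lambda>n. ?h (Suc n))"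
      using s1 by (rule summable_on_imp_summable)
    then have "summable ?h" by (rule summable_Suc_iff[THEN iffD1])
    then show ?thesis by (intro norm_summable_imp_summable_on) simp
  qed
  show ?thesis
    unfolding summable_on_def
  proof (rule exI, rule has_sum_int_split)
    show "((\<lambda>n. (norm (moment M (int n)))\<^sup>2 / (1 + \<bar>of_int (int n)\<bar>)) has_sum
      (\<Sum>\<^sub>\<infinity>n. (norm (moment M (int n)))\<^sup>2 / (1 + \<bar>of_int (int n)\<bar>))) UNIV"
      using s2 by simp
    show "((\<lambda>n. (norm (moment M (- int (Suc n))))\<^sup>2 / (1 + \<bar>of_int (- int (Suc n))\<bar>)) has_sum
      (\<Sum>\<^sub>\<infinity>n. (norm (moment M (int (Suc n))))\<^sup>2 / (1 + \<bar>of_int (int (Suc n))\<bar>))) UNIV"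
      using has_sum_infsum[OF s1] by (simp only: moment_minus complex_mod_cnj of_int_minus abs_minus)
  qed
qed

subsection \<open>The Dirichlet space\<close>

lemma dirichlet_spaceD:
  assumes "f \<in> dirichlet_space"
  shows "f \<in> borel_measurable arclength" "integrable arclength (\<lambda>z. (norm (f z))\<^sup>2)" "integrable arclength f"
    "(\<lambda>n::int. (1 + \<bar>of_int n\<bar>) * (norm (fourier_coeff f n))\<^sup>2 :: real) summable_on UNIV"
proof -
  show f: "f \<in> borel_measurable arclength" "integrable arclength (\<lambda>z. (norm (f z))\<^sup>2)"
    "(\<lambda>n::int. (1 + \<bar>of_int n\<bar>) * (norm (fourier_coeff f n))\<^sup>2 :: real) summable_on UNIV"
    using assms by (auto simp: dirichlet_space_def)
  show "integrable arclength f" by (rule integrable_of_square_integrable[OF f(1,2)])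
qed

lemma norm_linear_power2_le:
  fixes a b x y :: complex
  shows "(norm (a * x + b * y))\<^sup>2 \<le> 2 * (norm a)\<^sup>2 * (norm x)\<^sup>2 + 2 * (norm b)\<^sup>2 * (norm y)\<^sup>2"
proof -
  have "(norm (a * x + b * y))\<^sup>2 \<le> (norm a * norm x + norm b * norm y)\<^sup>2"
    by (intro power_mono order_trans[OF norm_triangle_ineq]) (auto simp: norm_mult)
  also have "\<dots> \<le> 2 * (norm a * norm x)\<^sup>2 + 2 * (norm b * norm y)\<^sup>2"
    using zero_le_power2[of "norm a * norm x - norm b * norm y"] by (simp add: power2_eq_square algebra_simps)
  finally show ?thesis by (simp add: power_mult_distrib)
qed

lemma dirichlet_space_linear:
  assumes f: "f \<in> dirichlet_space" and g: "g \<in> dirichlet_space"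
  shows "(\<lambda>z. a * f z + b * g z) \<in> dirichlet_space"
proof -
  note [measurable] = dirichlet_spaceD(1)[OF f] dirichlet_spaceD(1)[OF g]
  have [measurable]: "(\<lambda>z. a * f z + b * g z) \<in> borel_measurable arclength" by measurable
  have int: "integrable arclength (\<lambda>z. (norm (a * f z + b * g z))\<^sup>2)"
  proof (rule Bochner_Integration.integrable_bound)
    show "integrable arclength (\<lambda>z. 2 * (norm a)\<^sup>2 * (norm (f z))\<^sup>2 + 2 * (norm b)\<^sup>2 * (norm (g z))\<^sup>2)"
      using dirichlet_spaceD(2)[OF f] dirichlet_spaceD(2)[OF g] by auto
    show "AE z in arclength. norm ((norm (a * f z + b * g z))\<^sup>2) \<le>
        norm (2 * (norm a)\<^sup>2 * (norm (f z))\<^sup>2 + 2 * (norm b)\<^sup>2 * (norm (g z))\<^sup>2)"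
      by (intro AE_I2) (auto intro: order_trans[OF norm_linear_power2_le])
  qed measurable
  have "(\<lambda>n::int. (1 + \<bar>of_int n\<bar>) * (norm (fourier_coeff (\<lambda>z. a * f z + b * g z) n))\<^sup>2 :: real) summable_on UNIV"
  proof (rule summable_on_comparison_test)
    show "(\<lambda>n::int. 2 * (norm a)\<^sup>2 * ((1 + \<bar>of_int n\<bar>) * (norm (fourier_coeff f n))\<^sup>2)
        + 2 * (norm b)\<^sup>2 * ((1 + \<bar>of_int n\<bar>) * (norm (fourier_coeff g n))\<^sup>2)) summable_on UNIV"
      by (intro summable_on_add summable_on_cmult_right dirichlet_spaceD(4) f g)
    show "(1 + \<bar>of_int n\<bar>) * (norm (fourier_coeff (\<lambda>z. a * f z + b * g z) n))\<^sup>2 \<le>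
        2 * (norm a)\<^sup>2 * ((1 + \<bar>of_int n\<bar>) * (norm (fourier_coeff f n))\<^sup>2)
        + 2 * (norm b)\<^sup>2 * ((1 + \<bar>of_int n\<bar>) * (norm (fourier_coeff g n))\<^sup>2)" for n :: int
      unfolding fourier_coeff_linear[OF dirichlet_spaceD(3)[OF f] dirichlet_spaceD(3)[OF g]]
      using mult_left_mono[OF norm_linear_power2_le, of "1 + \<bar>of_int n\<bar>"] by (simp add: algebra_simps)
  qed auto
  then show ?thesis using int unfolding dirichlet_space_def by simp
qed

text \<open>Submultiplicativity of the weight \<open>1 + |n|\<close>. It makes multiplication by
  \<open>\<zeta>\<^sup>k\<close> act on the Dirichlet space and lets the pairing with shifted
  moments converge.\<close>

lemma weight_shift_le: "1 + \<bar>real_of_int n\<bar> \<le> (1 + \<bar>real_of_int k\<bar>) * (1 + \<bar>real_of_int (n - k)\<bar>)"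
proof -
  have "\<bar>real_of_int n\<bar> \<le> \<bar>real_of_int k\<bar> + \<bar>real_of_int (n - k)\<bar>" by simp
  moreover have "0 \<le> \<bar>real_of_int k\<bar> * \<bar>real_of_int (n - k)\<bar>" by simp
  ultimately have "\<bar>real_of_int n\<bar> \<le> \<bar>real_of_int k\<bar> + \<bar>real_of_int (n - k)\<bar> + \<bar>real_of_int k\<bar> * \<bar>real_of_int (n - k)\<bar>"
    by linarith
  then show ?thesis by (simp add: algebra_simps)
qed

lemma bij_shift_int: "bij (\<lambda>n::int. n + k)"
  by (rule bij_betw_byWitness[where f' = "\<lambda>n. n - k"]) auto

lemma dirichlet_space_shift:
  assumes f: "f \<in> dirichlet_space"
  shows "(\<lambda>z. z powi k * f z) \<in> dirichlet_space"
proof -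
  note [measurable] = dirichlet_spaceD(1)[OF f]
  have [measurable]: "(\<lambda>z. z powi k) \<in> borel_measurable arclength"
    by (intro arclength.measurable_circle borel_measurable_powi)
  have "integrable arclength (\<lambda>z. (norm (z powi k * f z))\<^sup>2) \<longleftrightarrow> integrable arclength (\<lambda>z. (norm (f z))\<^sup>2)"
    by (intro Bochner_Integration.integrable_cong refl) (use norm_powi_circle space_arclength in \<open>auto simp: norm_mult\<close>)
  moreover have "(\<lambda>n::int. (1 + \<bar>of_int n\<bar>) * (norm (fourier_coeff f (n - k)))\<^sup>2 :: real) summable_on UNIV"
  proof (rule summable_on_comparison_test)
    have "bij (\<lambda>n::int. n - k)" using bij_shift_int[of "- k"] by simp
    from summable_on_reindex_bij_betw[OF this, THEN iffD2, OF dirichlet_spaceD(4)[OF f]]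
    have "(\<lambda>n::int. (1 + \<bar>of_int (n - k)\<bar>) * (norm (fourier_coeff f (n - k)))\<^sup>2 :: real) summable_on UNIV" .
    then show "(\<lambda>n::int. (1 + \<bar>of_int k\<bar>) * ((1 + \<bar>of_int (n - k)\<bar>) * (norm (fourier_coeff f (n - k)))\<^sup>2) :: real) summable_on UNIV"
      by (rule summable_on_cmult_right)
    show "(1 + \<bar>of_int n\<bar>) * (norm (fourier_coeff f (n - k)))\<^sup>2 \<le>
      (1 + \<bar>of_int k\<bar>) * ((1 + \<bar>of_int (n - k)\<bar>) * (norm (fourier_coeff f (n - k)))\<^sup>2)" for n :: int
      using mult_right_mono[OF weight_shift_le[of n k]] by (simp add: mult.assoc)
  qed auto
  moreover have "(\<lambda>z. z powi k * f z) \<in> borel_measurable arclength" by measurable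
  ultimately show ?thesis
    using dirichlet_spaceD(2)[OF f] unfolding dirichlet_space_def by (simp add: fourier_coeff_shift)
qed

lemma shift_span_dirichlet:
  assumes f: "f \<in> dirichlet_space" and "finite N"
  shows "(\<lambda>z. \<Sum>n\<in>N. a n * (z ^ n * f z)) \<in> dirichlet_space"
    "fourier_coeff (\<lambda>z. \<Sum>n\<in>N. a n * (z ^ n * f z)) k = (\<Sum>n\<in>N. a n * fourier_coeff f (k - int n))"
  using \<open>finite N\<close>
proof (induction N)
  case empty
  {
    case 1
    show ?case using dirichlet_space_linear[OF f f, of 0 0] by simp
  next
    case 2
    show ?case by (simp add: fourier_coeff_def)
  }
next
  case (insert m N)
  have s: "(\<lambda>z. z ^ m * f z) \<in> dirichlet_space"
    using dirichlet_space_shift[OF f, of "int m"] by simp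
  {
    case 1
    show ?case using dirichlet_space_linear[OF s insert.IH(1), of "a m" 1] insert.hyps by simp
  next
    case 2
    show ?case
      using fourier_coeff_linear[OF dirichlet_spaceD(3)[OF s] dirichlet_spaceD(3)[OF insert.IH(1)], of "a m" 1]
        insert.hyps insert.IH(2) fourier_coeff_shift[of "int m" f] by simp
  }
qed

lemma one_in_dirichlet_space: "(\<lambda>_. 1) \<in> dirichlet_space"
proof -
  have "(\<lambda>n::int. (1 + \<bar>of_int n\<bar>) * (norm (fourier_coeff (\<lambda>_. 1) n))\<^sup>2 :: real) summable_on UNIV"
    by (rule finite_nonzero_values_imp_summable_on, rule finite_subset[of _ "{0}"]) (auto simp: fourier_coeff_one)
  then show ?thesis
    using arclength.finite_emeasure_space by (auto simp: dirichlet_space_def)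
qed

subsection \<open>The functional given by a measure\<close>

text \<open>The inequality \<open>u v \<le> u\<^sup>2 + v\<^sup>2\<close> after rescaling, as a
  replacement for Cauchy-Schwarz on infinite sums. With t = 1 it gives convergence of the pairing,
  and with t = \<epsilon> its smallness when the Dirichlet norm is below \<epsilon>.\<close>

lemma norm_mult_le_weighted:
  fixes x y :: complex
  assumes "t > 0" "w > 0"
  shows "norm (x * y) \<le> (1 / t) * (w * (norm x)\<^sup>2) + t * ((norm y)\<^sup>2 / w)"
proof -
  define u v where "u = sqrt (w / t) * norm x" and "v = norm y / sqrt (w / t)"
  have "u * v = norm (x * y)"
    using assms real_sqrt_gt_zero[of "w / t"] unfolding u_def v_def norm_mult by (simp del: real_sqrt_gt_0_iff)
  moreover have "u\<^sup>2 = (1 / t) * (w * (norm x)\<^sup>2)" "v\<^sup>2 = t * ((norm y)\<^sup>2 / w)"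
    using assms by (simp_all add: u_def v_def power_mult_distrib power_divide)
  moreover have "u * v \<le> u\<^sup>2 + v\<^sup>2"
    using zero_le_power2[of "u - v"] zero_le_power2[of u] zero_le_power2[of v]
    unfolding power2_diff by linarith
  ultimately show ?thesis by simp
qed

text \<open>For r < 1 the Poisson series converges uniformly on the circle and may be integrated
  against any finite measure, however singular. Multiplication by \<open>z powi k\<close> shifts the
  index of the moments.\<close>

lemma (in circle_measure) pairing_poisson_has_sum:
  assumes f: "integrable arclength f" and r: "0 \<le> r" "r < 1"
  shows "integrable M (\<lambda>z. poisson_integral f (of_real r * z) * z powi k)"
    "((\<lambda>n. of_real (r ^ nat \<bar>n\<bar>) * (fourier_coeff f n * moment M (n + k))) has_sum
      (LINT z|M. poisson_integral f (of_real r * z) * z powi k)) UNIV"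
proof -
  let ?F = "\<lambda>n z. of_real (r ^ nat \<bar>n\<bar>) * fourier_coeff f n * z powi n * z powi k"
  let ?S = "\<lambda>z. poisson_integral f (of_real r * z) * z powi k"
  have F: "(LINT z|M. ?F n z) = of_real (r ^ nat \<bar>n\<bar>) * (fourier_coeff f n * moment M (n + k))" for n
  proof -
    have "(LINT z|M. ?F n z) = (LINT z|M. (of_real (r ^ nat \<bar>n\<bar>) * fourier_coeff f n) * z powi (n + k))"
    proof (intro Bochner_Integration.integral_cong refl)
      fix z assume "z \<in> space M"
      then have "z \<noteq> 0" by (auto simp: space_eq)
      then show "?F n z = (of_real (r ^ nat \<bar>n\<bar>) * fourier_coeff f n) * z powi (n + k)"
        by (simp add: power_int_add)
    qed
    then show ?thesis by (simp add: moment_def)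
  qed
  have sf: "sigma_finite_measure M" by unfold_locales
  have meas: "?F n \<in> borel_measurable M" for n using measurable_powi by measurable
  have bound: "norm (?F n z) \<le> r ^ nat \<bar>n\<bar> * (LINT z|arclength. norm (f z))" if "z \<in> space M" for n z
  proof -
    have "norm (?F n z) = r ^ nat \<bar>n\<bar> * norm (fourier_coeff f n)"
      using that norm_powi_circle[of z] r by (simp add: space_eq norm_mult norm_power)
    then show ?thesis using norm_fourier_coeff_le[of f n] r by (simp add: mult_left_mono)
  qed
  have sums: "((\<lambda>n. ?F n z) has_sum ?S z) UNIV" if "z \<in> space M" for z
    using that r f by (intro has_sum_cmult_left poisson_integral_has_sum) (auto simp: space_eq)
  note * = has_sum_integral[of M ?F "\<lambda>n. r ^ nat \<bar>n\<bar>" "\<lambda>_. LINT z|arclength. norm (f z)" ?S,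
      OF sf meas summable_on_power_abs[OF r] _ _ bound sums]
  show "integrable M ?S" by (rule *(1)) (use r in auto)
  show "((\<lambda>n. of_real (r ^ nat \<bar>n\<bar>) * (fourier_coeff f n * moment M (n + k))) has_sum (LINT z|M. ?S z)) UNIV"
    unfolding F[symmetric] by (rule *(2)) (use r in auto)
qed

text \<open>Finite energy is recorded by its consequence for the moments: they lie in the weighted
  \<open>l\<^sup>2\<close> space dual to that of the Fourier coefficients of Dirichlet
  functions.\<close>

locale finite_energy_measure = circle_measure +
  assumes moments: "(\<lambda>n::int. (norm (moment M n))\<^sup>2 / (1 + \<bar>of_int n\<bar>)) summable_on UNIV"
begin

lemma pairing_summable:
  assumes "f \<in> dirichlet_space"
  shows "(\<lambda>n. norm (fourier_coeff f n * moment M (n + k))) summable_on UNIV"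
proof (rule summable_on_comparison_test)
  have "(\<lambda>n. (norm (moment M (n + k)))\<^sup>2 / (1 + \<bar>of_int (n + k)\<bar>)) summable_on UNIV"
    using summable_on_reindex_bij_betw[OF bij_shift_int[of k], THEN iffD2, OF moments] .
  then show "(\<lambda>n. 1 * ((1 + \<bar>of_int n\<bar>) * (norm (fourier_coeff f n))\<^sup>2)
      + (1 + \<bar>of_int k\<bar>) * ((norm (moment M (n + k)))\<^sup>2 / (1 + \<bar>of_int (n + k)\<bar>))) summable_on UNIV"
    by (intro summable_on_add summable_on_cmult_right dirichlet_spaceD(4) assms)
  fix n :: int
  \<comment> \<open>The coefficients carry the weight at n, the moments the one at n + k; exchanging
    them costs the factor \<open>1 + |k|\<close>.\<close>
  have "(norm (moment M (n + k)))\<^sup>2 / (1 + \<bar>of_int n\<bar>)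
    \<le> (1 + \<bar>of_int k\<bar>) * ((norm (moment M (n + k)))\<^sup>2 / (1 + \<bar>of_int (n + k)\<bar>))"
  proof -
    have "1 + \<bar>real_of_int (n + k)\<bar> \<le> (1 + \<bar>of_int k\<bar>) * (1 + \<bar>of_int n\<bar>)"
      using weight_shift_le[of "n + k" k] by simp
    from mult_left_mono[OF this, of "(norm (moment M (n + k)))\<^sup>2"]
    show ?thesis by (simp add: divide_le_eq pos_le_divide_eq mult_ac add_pos_nonneg)
  qed
  then show "norm (fourier_coeff f n * moment M (n + k)) \<le> 1 * ((1 + \<bar>of_int n\<bar>) * (norm (fourier_coeff f n))\<^sup>2)
      + (1 + \<bar>of_int k\<bar>) * ((norm (moment M (n + k)))\<^sup>2 / (1 + \<bar>of_int (n + k)\<bar>))"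
    using norm_mult_le_weighted[of 1 "1 + \<bar>of_int n\<bar>" "fourier_coeff f n" "moment M (n + k)"]
    by (simp add: add_pos_nonneg)
qed auto

lemma pairing_bound:
  assumes u: "u \<in> dirichlet_space" and "\<epsilon> > 0" and "dirichlet_norm u < \<epsilon>"
  shows "norm (\<Sum>\<^sub>\<infinity>n. fourier_coeff u n * moment M n)
    \<le> \<epsilon> * (1 + (\<Sum>\<^sub>\<infinity>n. (norm (moment M n))\<^sup>2 / (1 + \<bar>of_int n\<bar>)))"
proof -
  let ?D = "\<lambda>n::int. (1 + \<bar>of_int n\<bar>) * (norm (fourier_coeff u n))\<^sup>2 :: real"
  let ?M = "\<lambda>n::int. (norm (moment M n))\<^sup>2 / (1 + \<bar>of_int n\<bar>)"
  have le: "norm (fourier_coeff u n * moment M n) \<le> (1 / \<epsilon>) * ?D n + \<epsilon> * ?M n" for n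
    by (rule norm_mult_le_weighted) (use assms(2) in \<open>simp_all add: add_pos_nonneg\<close>)
  have "norm (\<Sum>\<^sub>\<infinity>n. fourier_coeff u n * moment M n) \<le> (\<Sum>\<^sub>\<infinity>n. norm (fourier_coeff u n * moment M n))"
    using pairing_summable[OF u, of 0] by (intro norm_infsum_bound) simp
  also have "\<dots> \<le> (\<Sum>\<^sub>\<infinity>n. (1 / \<epsilon>) * ?D n + \<epsilon> * ?M n)"
    by (rule infsum_mono[OF _ summable_on_add[OF summable_on_cmult_right[OF dirichlet_spaceD(4)[OF u]] summable_on_cmult_right[OF moments]] le])
      (use pairing_summable[OF u, of 0] in simp)
  also have "\<dots> = (1 / \<epsilon>) * infsum ?D UNIV + \<epsilon> * infsum ?M UNIV"
    using infsum_add[OF summable_on_cmult_right[OF dirichlet_spaceD(4)[OF u]] summable_on_cmult_right[OF moments]]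
    by (simp only: infsum_cmult_right')
  also have "\<dots> \<le> (1 / \<epsilon>) * \<epsilon>\<^sup>2 + \<epsilon> * infsum ?M UNIV"
  proof -
    have "infsum ?D UNIV \<le> \<epsilon>\<^sup>2"
      using assms(2,3) by (intro sqrt_le_D less_imp_le) (simp add: dirichlet_norm_def)
    then show ?thesis using assms(2) by (intro add_right_mono mult_left_mono) simp_all
  qed
  also have "\<dots> = \<epsilon> * (1 + infsum ?M UNIV)" using assms(2) by (simp add: power2_eq_square distrib_left)
  finally show ?thesis .
qed

text \<open>The sum is the value of the functional at \<open>\<zeta>\<^sup>k f\<close>. Its Abel
  means along \<open>r\<close> equal integrals of Poisson integrals over \<open>M\<close>. Dominated
  convergence is applied on both sides: to the sum, with the majorant from
  \<open>pairing_summable\<close>, and to the integrals, with the constant \<open>C\<close>.\<close>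

lemma pairing_eq_0:
  assumes f: "f \<in> dirichlet_space"
    and r: "\<And>j. 0 \<le> r j" "\<And>j. r j < 1" "r \<longlonglongrightarrow> 1"
    and bounded: "AE z in M. \<forall>j. norm (poisson_integral f (of_real (r j) * z)) \<le> C"
    and lim: "AE z in M. (\<lambda>j. poisson_integral f (of_real (r j) * z)) \<longlonglongrightarrow> 0"
  shows "((\<lambda>n. fourier_coeff f n * moment M (n + k)) has_sum 0) UNIV"
proof -
  let ?c = "\<lambda>n. fourier_coeff f n * moment M (n + k)"
  let ?C = "count_space (UNIV :: int set)"
  let ?P = "\<lambda>j z. poisson_integral f (of_real (r j) * z) * z powi k"
  have si: "integrable ?C (\<lambda>n. norm (?c n))"
    using pairing_summable[OF f, of k] abs_summable_equivalent[of ?c UNIV] by (simp add: abs_summable_on_def)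
  have eq: "(\<integral>n. of_real (r j ^ nat \<bar>n\<bar>) * ?c n \<partial>?C) = (LINT z|M. ?P j z)" for j
  proof -
    note h = pairing_poisson_has_sum(2)[OF dirichlet_spaceD(3)[OF f] r(1)[of j] r(2)[of j], of k]
    have "(\<lambda>n. norm (of_real (r j ^ nat \<bar>n\<bar>) * ?c n)) summable_on UNIV"
    proof (rule summable_on_comparison_test[OF pairing_summable[OF f, of k]])
      show "norm (of_real (r j ^ nat \<bar>n\<bar>) * ?c n) \<le> norm (?c n)" for n
        using power_le_one[OF r(1)[of j] less_imp_le[OF r(2)[of j]], of "nat \<bar>n\<bar>"] r(1)[of j]
        by (simp add: norm_mult norm_power mult_left_le_one_le)
    qed auto
    from integral_count_space_eq_infsum[OF this] show ?thesis by (simp only: infsumI[OF h])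
  qed
  have "(\<lambda>j. \<integral>n. of_real (r j ^ nat \<bar>n\<bar>) * ?c n \<partial>?C) \<longlonglongrightarrow> (\<integral>n. ?c n \<partial>?C)"
  proof (rule integral_dominated_convergence[where w = "\<lambda>n. norm (?c n)"])
    show "AE n in ?C. (\<lambda>j. of_real (r j ^ nat \<bar>n\<bar>) * ?c n) \<longlonglongrightarrow> ?c n"
    proof (rule AE_I2)
      fix n
      have "(\<lambda>j. of_real (r j ^ nat \<bar>n\<bar>) * ?c n) \<longlonglongrightarrow> of_real (1 ^ nat \<bar>n\<bar>) * ?c n"
        by (intro tendsto_intros r(3))
      then show "(\<lambda>j. of_real (r j ^ nat \<bar>n\<bar>) * ?c n) \<longlonglongrightarrow> ?c n" by simp
    qed
    show "AE n in ?C. norm (of_real (r j ^ nat \<bar>n\<bar>) * ?c n) \<le> norm (?c n)" for j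
      using power_le_one[OF r(1)[of j] less_imp_le[OF r(2)[of j]]] r(1)[of j]
      by (intro AE_I2) (simp add: norm_mult norm_power mult_left_le_one_le)
  qed (use si in auto)
  moreover have "(\<lambda>j. LINT z|M. ?P j z) \<longlonglongrightarrow> (LINT z|M. 0)"
  proof (rule integral_dominated_convergence[where w = "\<lambda>_. C"])
    show "?P j \<in> borel_measurable M" for j
      using pairing_poisson_has_sum(1)[OF dirichlet_spaceD(3)[OF f] r(1)[of j] r(2)[of j], of k] by auto
    show "AE z in M. (\<lambda>j. ?P j z) \<longlonglongrightarrow> 0"
      using lim by eventually_elim (auto intro: tendsto_mult_left_zero)
    show "AE z in M. norm (?P j z) \<le> C" for j
      using bounded AE_space by eventually_elim (use norm_powi_circle in \<open>auto simp: norm_mult space_eq\<close>)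
  qed auto
  ultimately have "(\<integral>n. ?c n \<partial>?C) = 0"
    unfolding eq by (intro LIMSEQ_unique) auto
  then have "infsum ?c UNIV = 0"
    using integral_count_space_eq_infsum[OF pairing_summable[OF f, of k]] by simp
  then show ?thesis
    using has_sum_infsum[OF abs_summable_summable[OF pairing_summable[OF f, of k]]] by simp
qed

lemma measure_eq_0_of_cyclic:
  assumes f: "f \<in> dirichlet_space" and "cyclic f"
    and z: "\<And>k. ((\<lambda>n. fourier_coeff f n * moment M (n + k)) has_sum 0) UNIV"
  shows "measure M circle = 0"
proof -
  \<comment> \<open>The constant of \<open>pairing_bound\<close>; approximating 1 up to
    \<open>\<epsilon> / K\<close> bounds the mass by \<epsilon>.\<close>
  define K where "K = 1 + (\<Sum>\<^sub>\<infinity>n. (norm (moment M n))\<^sup>2 / (1 + \<bar>of_int n\<bar>))"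
  have K: "K \<ge> 1" unfolding K_def by (simp add: infsum_nonneg)
  have m0: "moment M 0 = of_real (measure M circle)"
    by (simp add: moment_def space_eq scaleR_conv_of_real)
  have "measure M circle \<le> \<epsilon>" if "\<epsilon> > 0" for \<epsilon>
  proof -
    have "(\<lambda>_. 1) \<in> shift_closure f"
      using one_in_dirichlet_space \<open>cyclic f\<close> by (simp add: cyclic_def)
    moreover have "\<epsilon> / K > 0" using that K by simp
    ultimately obtain h where h: "h \<in> shift_span f" "dirichlet_norm (\<lambda>z. 1 - h z) < \<epsilon> / K"
      unfolding shift_closure_def by blast
    then obtain a N where N: "finite N" and h_eq: "h = (\<lambda>z. \<Sum>n\<in>N. a n * (z ^ n * f z))"
      unfolding shift_span_def by blast
    note hd = shift_span_dirichlet[OF f N, of a, folded h_eq]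
    have u: "(\<lambda>z. 1 - h z) \<in> dirichlet_space"
      using dirichlet_space_linear[OF one_in_dirichlet_space hd(1), of 1 "-1"] by simp
    have cu: "fourier_coeff (\<lambda>z. 1 - h z) n = fourier_coeff (\<lambda>_. 1) n - (\<Sum>k\<in>N. a k * fourier_coeff f (n - int k))" for n
      using fourier_coeff_linear[OF dirichlet_spaceD(3)[OF one_in_dirichlet_space] dirichlet_spaceD(3)[OF hd(1)], of 1 "-1" n]
        hd(2)[of n] by simp
    \<comment> \<open>The substitution n \<mapsto> n + k moves the shift from the coefficients of
      \<open>\<zeta>\<^sup>k f\<close> to the moments, where the hypothesis applies.\<close>
    have sh: "((\<lambda>n. fourier_coeff f (n - int k) * moment M n) has_sum 0) UNIV" for k
      by (rule has_sum_reindex_bij_betw[OF bij_shift_int[of "int k"], THEN iffD1]) (use z[of "int k"] in simp)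
    have "((\<lambda>n. \<Sum>k\<in>N. a k * (fourier_coeff f (n - int k) * moment M n)) has_sum 0) UNIV"
      using N
    proof (induction N)
      case (insert k N)
      then show ?case using has_sum_add[OF has_sum_cmult_right[OF sh[of k], of "a k"] insert.IH] by simp
    qed simp
    moreover have "((\<lambda>n. fourier_coeff (\<lambda>_. 1) n * moment M n) has_sum moment M 0) UNIV"
      by (rule has_sum_finite_neutralI[of "{0}"]) (auto simp: fourier_coeff_one)
    ultimately have "((\<lambda>n. fourier_coeff (\<lambda>_. 1) n * moment M n
       + (- 1) * (\<Sum>k\<in>N. a k * (fourier_coeff f (n - int k) * moment M n))) has_sum (moment M 0 + (- 1) * 0)) UNIV"
      by (intro has_sum_add has_sum_cmult_right)
    then have pair: "((\<lambda>n. fourier_coeff (\<lambda>z. 1 - h z) n * moment M n) has_sum moment M 0) UNIV"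
      unfolding cu by (simp add: left_diff_distrib sum_distrib_right mult.assoc)
    from pairing_bound[OF u \<open>\<epsilon> / K > 0\<close> h(2)]
    have "norm (moment M 0) \<le> \<epsilon> / K * K"
      unfolding K_def[symmetric] infsumI[OF pair] .
    then show ?thesis using K m0 by simp
  qed
  then show ?thesis
    by (rule antisym[OF dense_ge measure_nonneg])
qed

end

subsection \<open>The capacity of the zero set\<close>

text \<open>Points of the circle are at distance at most 2, so the kernel is at least - log 2 and
  its negative part has a finite integral. An infinite positive part would thus make the energy
  infinite.\<close>

lemma nn_integral_energy_finite:
  assumes "prob_space M" and sets: "sets M = sets (restrict_space borel circle)" and "energy M \<noteq> \<infinity>"
  shows "(\<integral>\<^sup>+p. e2ennreal (- elog (norm (fst p - snd p))) \<partial>(M \<Otimes>\<^sub>M M)) < \<infinity>"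
proof (rule ccontr)
  interpret prob_space M by fact
  interpret circle_measure M by unfold_locales (rule sets)
  interpret PM: finite_measure "M \<Otimes>\<^sub>M M"
    by (intro finite_measure_pair_measure) unfold_locales
  assume "\<not> ?thesis"
  then have "(\<integral>\<^sup>+p. e2ennreal (- elog (norm (fst p - snd p))) \<partial>(M \<Otimes>\<^sub>M M)) = \<infinity>"
    by (simp add: less_top[symmetric])
  moreover have "(\<integral>\<^sup>+p. e2ennreal (elog (norm (fst p - snd p))) \<partial>(M \<Otimes>\<^sub>M M)) \<noteq> \<infinity>"
  proof -
    have "(\<integral>\<^sup>+p. e2ennreal (elog (norm (fst p - snd p))) \<partial>(M \<Otimes>\<^sub>M M)) \<le> (\<integral>\<^sup>+p. ennreal (ln 2) \<partial>(M \<Otimes>\<^sub>M M))"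
    proof (intro nn_integral_mono)
      fix p assume "p \<in> space (M \<Otimes>\<^sub>M M)"
      then have "norm (fst p - snd p) \<le> 2"
        using norm_triangle_ineq4[of "fst p" "snd p"] by (auto simp: space_pair_measure space_eq)
      moreover have "ln (norm (fst p - snd p)) \<le> ln 2" if "fst p \<noteq> snd p"
        using that calculation by (intro ln_mono) auto
      ultimately show "e2ennreal (elog (norm (fst p - snd p))) \<le> ennreal (ln 2)"
        by (auto simp: elog_def e2ennreal_neg intro: ennreal_leI)
    qed
    also have "\<dots> < \<infinity>" using PM.emeasure_finite by (simp add: ennreal_mult_eq_top_iff less_top[symmetric])
    finally show ?thesis by simp
  qed
  ultimately have "energy M = \<infinity>"
    by (simp add: energy_def ereal_integral_def case_prod_beta)
  then show False using assms(3) by simp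
qed

lemma log_capacity_zero_set:
  assumes f: "f \<in> dirichlet_space" and cyc: "cyclic f"
  shows "log_capacity (zero_set f) = 0"
proof -
  have "energy \<mu> = \<infinity>" if \<mu>: "\<mu> \<in> prob_measures_on (zero_set f)" for \<mu>
  proof (rule ccontr)
    assume fin: "energy \<mu> \<noteq> \<infinity>"
    from \<mu> obtain K where K: "K \<subseteq> zero_set f" "compact K" "K \<subseteq> circle" "emeasure \<mu> (circle - K) = 0"
      and prob: "prob_space \<mu>" and sets: "sets \<mu> = sets (restrict_space borel circle)"
      unfolding prob_measures_on_def by blast
    interpret prob_space \<mu> by fact
    interpret circle_measure \<mu> by unfold_locales (rule sets)
    \<comment> \<open>Passing from all radii to a sequence makes the sets \<open>S N\<close> below
      countable intersections, hence measurable.\<close>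
    define r where "r j = 1 - 1 / real (j + 2)" for j
    have r: "0 \<le> r j" "r j < 1" for j by (auto simp: r_def)
    have r1: "r \<longlonglongrightarrow> 1" unfolding r_def by real_asymp
    have r_left: "filterlim r (at_left 1) sequentially"
      using r r1 by (intro tendsto_imp_filterlim_at_left) (auto intro!: always_eventually)
    define P where "P j z = poisson_integral f (of_real (r j) * z)" for j z
    have P [measurable]: "P j \<in> borel_measurable \<mu>" for j
      using pairing_poisson_has_sum(1)[OF dirichlet_spaceD(3)[OF f] r(1)[of j] r(2)[of j], of 0]
      by (auto simp: P_def[abs_def])
    define S where "S N = {z \<in> space \<mu>. \<forall>j. norm (P j z) \<le> real N}" for N
    have S [measurable]: "S N \<in> sets \<mu>" for N unfolding S_def by measurable
    have P0: "(\<lambda>j. P j z) \<longlonglongrightarrow> 0" if "z \<in> K" for z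
    proof -
      have "((\<lambda>r::real. poisson_integral f (of_real r * z)) \<longlongrightarrow> 0) (at_left 1)"
        using K(1) that by (auto simp: zero_set_def)
      from filterlim_compose[OF this r_left] show ?thesis by (simp add: P_def)
    qed
    have nullK: "AE z in \<mu>. z \<in> K"
    proof (rule AE_I)
      show "{z \<in> space \<mu>. \<not> z \<in> K} \<subseteq> circle - K" by (auto simp: space_eq)
      show "circle - K \<in> sets \<mu>"
        unfolding sets sets_restrict_space using K(2) by (intro image_eqI[of _ _ "- K"]) (auto intro!: borel_open open_Compl compact_imp_closed)
    qed fact
    \<comment> \<open>Convergent sequences are bounded, so the sets \<open>S N\<close> cover
      \<open>K\<close>, which carries \<mu>. Countably many null sets cannot do that.\<close>
    have "\<exists>N. emeasure \<mu> (S N) \<noteq> 0"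
    proof (rule ccontr)
      assume "\<not> ?thesis"
      then have "AE z in \<mu>. \<forall>N. z \<notin> S N"
        using S by (subst AE_all_countable) (auto intro!: AE_not_in)
      with nullK have "AE z in \<mu>. False"
        using AE_space
      proof eventually_elim
        case (elim z)
        from P0[OF elim(1)] have "Bseq (\<lambda>j. P j z)" by (intro convergent_imp_Bseq convergentI)
        then obtain B where "\<And>j. norm (P j z) \<le> B" unfolding Bseq_def by blast
        moreover obtain N where "B \<le> real N" using real_arch_simple by blast
        ultimately have "z \<in> S N" using elim(3) by (auto simp: S_def intro: order_trans)
        then show False using elim(2) by blast
      qed
      then show False by simp
    qed
    then obtain N where N: "emeasure \<mu> (S N) \<noteq> 0" by blast
    \<comment> \<open>As a density the restriction keeps the sigma-algebra of \<mu>, and its product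
      with itself is a density with values at most 1 for the product of \<mu> with itself. The
      integral of the nonnegative part of the kernel can only decrease.\<close>
    define \<nu> where "\<nu> = density \<mu> (indicator (S N))"
    have \<nu>_circle: "emeasure \<nu> circle = emeasure \<mu> (S N)"
    proof -
      have "S N \<inter> circle = S N" by (auto simp: S_def space_eq)
      then show ?thesis
        using S space_eq sets.top[of \<mu>]
        by (simp add: \<nu>_def emeasure_density nn_integral_indicator indicator_inter_arith[symmetric])
    qed
    have finite: "finite_measure \<nu>"
      by (rule finite_measureI) (use \<nu>_circle emeasure_finite in \<open>simp add: \<nu>_def space_eq\<close>)
    interpret \<nu>: circle_measure \<nu>
      by (intro circle_measure.intro finite circle_measure_axioms.intro) (simp add: \<nu>_def sets)
    have "\<nu> \<Otimes>\<^sub>M \<nu> = density (\<mu> \<Otimes>\<^sub>M \<mu>) (\<lambda>(x, y). indicator (S N) x * indicator (S N) y)"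
      using finite unfolding \<nu>_def
      by (intro pair_measure_density borel_measurable_indicator S sigma_finite_measure_axioms finite_measure.axioms(1))
    moreover have [measurable]: "fst \<in> borel_measurable (\<mu> \<Otimes>\<^sub>M \<mu>)" "snd \<in> borel_measurable (\<mu> \<Otimes>\<^sub>M \<mu>)"
      using measurable_compose[OF measurable_fst, of "\<lambda>z. z" \<mu> borel \<mu>] measurable_compose[OF measurable_snd, of "\<lambda>z. z" \<mu> borel \<mu>]
      by (auto simp: measurable_circle)
    moreover have "(\<lambda>p. e2ennreal (- elog (norm (fst p - snd p)))) \<in> borel_measurable (\<mu> \<Otimes>\<^sub>M \<mu>)"
      by measurable
    ultimately have "(\<integral>\<^sup>+p. e2ennreal (- elog (norm (fst p - snd p))) \<partial>(\<nu> \<Otimes>\<^sub>M \<nu>))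
       = (\<integral>\<^sup>+p. (case p of (x, y) \<Rightarrow> indicator (S N) x * indicator (S N) y) * e2ennreal (- elog (norm (fst p - snd p))) \<partial>(\<mu> \<Otimes>\<^sub>M \<mu>))"
      by (simp add: nn_integral_density)
    also have "\<dots> \<le> (\<integral>\<^sup>+p. e2ennreal (- elog (norm (fst p - snd p))) \<partial>(\<mu> \<Otimes>\<^sub>M \<mu>))"
      by (intro nn_integral_mono) (auto simp: indicator_def)
    also have "\<dots> < \<infinity>" by (rule nn_integral_energy_finite[OF prob sets fin])
    finally interpret \<nu>: finite_energy_measure \<nu>
      by unfold_locales (rule \<nu>.summable_moments)
    have "AE z in \<nu>. \<forall>j. norm (P j z) \<le> real N"
      unfolding \<nu>_def using S by (subst AE_density) (auto simp: S_def indicator_def split: if_splits)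
    moreover have "AE z in \<nu>. (\<lambda>j. P j z) \<longlonglongrightarrow> 0"
      unfolding \<nu>_def using S nullK by (subst AE_density) (auto intro: P0)
    ultimately have "((\<lambda>n. fourier_coeff f n * moment \<nu> (n + k)) has_sum 0) UNIV" for k
      unfolding P_def by (rule \<nu>.pairing_eq_0[OF f r r1])
    then have "measure \<nu> circle = 0" by (rule \<nu>.measure_eq_0_of_cyclic[OF f cyc])
    then show False using N \<nu>_circle \<nu>.emeasure_eq_measure[of circle] by simp
  qed
  then have "(INF \<mu>\<in>prob_measures_on (zero_set f). energy \<mu>) = \<infinity>"
    by (intro antisym INF_greatest) auto
  then show ?thesis by (simp add: log_capacity_def)
qed

subsection \<open>Density of trigonometric polynomials and Parseval's inequality\<close>

text \<open>Equality is demanded on the circle only, since identities such as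
  \<open>cnj z = z powi (-1)\<close> hold just there.\<close>

definition trig_poly :: "(complex \<Rightarrow> complex) \<Rightarrow> bool" where
  "trig_poly p \<longleftrightarrow> (\<exists>F c. finite F \<and> (\<forall>z\<in>circle. p z = (\<Sum>n\<in>F. c n * z powi n)))"

lemma trig_poly_powi: "trig_poly (\<lambda>z. c * z powi n)"
  unfolding trig_poly_def by (intro exI[of _ "{n}"] exI[of _ "\<lambda>_. c"]) simp

lemma trig_poly_cong: "trig_poly q \<Longrightarrow> (\<And>z. z \<in> circle \<Longrightarrow> p z = q z) \<Longrightarrow> trig_poly p"
  unfolding trig_poly_def by simp

lemma trig_poly_add:
  assumes "trig_poly p" "trig_poly q"
  shows "trig_poly (\<lambda>z. p z + q z)"
proof -
  obtain F c where F: "finite F" "\<forall>z\<in>circle. p z = (\<Sum>n\<in>F. c n * z powi n)"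
    using assms(1) unfolding trig_poly_def by blast
  obtain G d where G: "finite G" "\<forall>z\<in>circle. q z = (\<Sum>n\<in>G. d n * z powi n)"
    using assms(2) unfolding trig_poly_def by blast
  have "p z + q z = (\<Sum>n\<in>F \<union> G. ((if n \<in> F then c n else 0) + (if n \<in> G then d n else 0)) * z powi n)"
    if "z \<in> circle" for z
  proof -
    have "(\<Sum>n\<in>F \<union> G. (if n \<in> F then c n else 0) * z powi n) = p z"
      using F that G(1) by (auto intro!: sum.mono_neutral_cong_right)
    moreover have "(\<Sum>n\<in>F \<union> G. (if n \<in> G then d n else 0) * z powi n) = q z"
      using G that F(1) by (auto intro!: sum.mono_neutral_cong_right)
    ultimately show ?thesis by (simp only: distrib_right sum.distrib)
  qed
  then show ?thesis
    unfolding trig_poly_def using F(1) G(1) by (intro exI[of _ "F \<union> G"] exI conjI finite_UnI) auto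
qed

lemma trig_poly_sum: "finite A \<Longrightarrow> (\<And>i. i \<in> A \<Longrightarrow> trig_poly (p i)) \<Longrightarrow> trig_poly (\<lambda>z. \<Sum>i\<in>A. p i z)"
proof (induction A rule: finite_induct)
  case empty
  show ?case using trig_poly_powi[of 0 0] by simp
next
  case (insert i A)
  then show ?case using trig_poly_add[of "p i" "\<lambda>z. \<Sum>i\<in>A. p i z"] by simp
qed

lemma trig_poly_mult:
  assumes "trig_poly p" "trig_poly q"
  shows "trig_poly (\<lambda>z. p z * q z)"
proof -
  obtain F c where F: "finite F" "\<forall>z\<in>circle. p z = (\<Sum>n\<in>F. c n * z powi n)"
    using assms(1) unfolding trig_poly_def by blast
  obtain G d where G: "finite G" "\<forall>z\<in>circle. q z = (\<Sum>n\<in>G. d n * z powi n)"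
    using assms(2) unfolding trig_poly_def by blast
  have "trig_poly (\<lambda>z. \<Sum>n\<in>F. \<Sum>m\<in>G. (c n * d m) * z powi (n + m))"
    by (intro trig_poly_sum F(1) G(1) trig_poly_powi)
  then show ?thesis
  proof (rule trig_poly_cong)
    fix z assume z: "z \<in> circle"
    then have "z \<noteq> 0" by auto
    then show "p z * q z = (\<Sum>n\<in>F. \<Sum>m\<in>G. (c n * d m) * z powi (n + m))"
      using F(2) G(2) z by (simp add: sum_product power_int_add ac_simps)
  qed
qed

lemma trig_poly_const: "trig_poly (\<lambda>_. c)"
  using trig_poly_powi[of c 0] by simp

text \<open>Stone-Weierstrass provides real polynomials in the coordinates of the plane. A
  real-linear function is a combination of Re z and Im z, which on the circle are combinations of
  \<open>z\<close> and \<open>z powi (-1)\<close>; sums and products stay trigonometric.\<close>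

lemma trig_poly_real_polynomial:
  fixes g :: "complex \<Rightarrow> real"
  assumes "real_polynomial_function g"
  shows "trig_poly (\<lambda>z. of_real (g z))"
  using assms
proof induction
  case (linear g)
  interpret bounded_linear g by fact
  have "trig_poly (\<lambda>z. of_real (g 1) * ((1/2) * z powi 1 + (1/2) * z powi (-1))
      + of_real (g \<i>) * ((1 / (2 * \<i>)) * z powi 1 + (- 1 / (2 * \<i>)) * z powi (-1)))"
    by (intro trig_poly_add trig_poly_mult trig_poly_const trig_poly_powi)
  then show ?case
  proof (rule trig_poly_cong)
    fix z assume "z \<in> circle"
    then have "z powi (-1) = cnj z" by (simp add: cnj_circle power_int_minus)
    moreover have "g z = Re z * g 1 + Im z * g \<i>"
    proof -
      have "z = Re z *\<^sub>R 1 + Im z *\<^sub>R \<i>" by (simp add: complex_eq_iff)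
      then have "g z = g (Re z *\<^sub>R 1 + Im z *\<^sub>R \<i>)" by simp
      then show ?thesis by (simp only: add scaleR real_scaleR_def)
    qed
    moreover have "(1/2) * z + (1/2) * cnj z = of_real (Re z)"
      "(1 / (2 * \<i>)) * z + (- 1 / (2 * \<i>)) * cnj z = of_real (Im z)"
      by (simp_all add: complex_eq_iff)
    ultimately show "of_real (g z) = of_real (g 1) * ((1/2) * z powi 1 + (1/2) * z powi (-1))
      + of_real (g \<i>) * ((1 / (2 * \<i>)) * z powi 1 + (- 1 / (2 * \<i>)) * z powi (-1))"
      by (simp only: power_int_1_right of_real_add of_real_mult mult.commute)
  qed
qed (auto intro: trig_poly_const trig_poly_add trig_poly_mult)

lemma trig_poly_bounded_measurable:
  assumes "trig_poly p"
  shows "p \<in> borel_measurable arclength" "\<exists>B. \<forall>z\<in>circle. norm (p z) \<le> B"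
proof -
  obtain F c where F: "finite F" "\<And>z. z \<in> circle \<Longrightarrow> p z = (\<Sum>n\<in>F. c n * z powi n)"
    using assms unfolding trig_poly_def by blast
  have "(\<lambda>z. \<Sum>n\<in>F. c n * z powi n) \<in> borel_measurable arclength"
    by (rule arclength.measurable_circle) measurable
  then show "p \<in> borel_measurable arclength"
    using F(2) by (subst measurable_cong[of _ _ "\<lambda>z. \<Sum>n\<in>F. c n * z powi n"]) (auto simp: space_arclength)
  have "norm (p z) \<le> (\<Sum>n\<in>F. norm (c n))" if "z \<in> circle" for z
  proof -
    have "norm (p z) \<le> (\<Sum>n\<in>F. norm (c n * z powi n))"
      unfolding F(2)[OF that] by (rule norm_sum)
    then show ?thesis using norm_powi_circle[OF that] by (simp add: norm_mult)
  qed
  then show "\<exists>B. \<forall>z\<in>circle. norm (p z) \<le> B" by blast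
qed

definition square_integrable :: "(complex \<Rightarrow> complex) \<Rightarrow> bool" where
  "square_integrable u \<longleftrightarrow> u \<in> borel_measurable arclength \<and> integrable arclength (\<lambda>z. (norm (u z))\<^sup>2)"

lemma integrable_of_square_integrable': "square_integrable u \<Longrightarrow> integrable arclength u"
  unfolding square_integrable_def by (intro integrable_of_square_integrable) auto

lemma square_integrable_bounded:
  assumes "u \<in> borel_measurable arclength" "\<And>z. z \<in> circle \<Longrightarrow> norm (u z) \<le> B"
  shows "square_integrable u"
  unfolding square_integrable_def
proof
  show "integrable arclength (\<lambda>z. (norm (u z))\<^sup>2)"
    by (rule arclength.integrable_bounded_circle[of _ "B\<^sup>2"]) (use assms in \<open>auto intro!: power_mono\<close>)
qed fact

lemma square_integrable_linear:
  assumes "square_integrable u" "square_integrable v"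
  shows "square_integrable (\<lambda>z. a * u z + b * v z)"
    "(LINT z|arclength. (norm (a * u z + b * v z))\<^sup>2) \<le>
       2 * (norm a)\<^sup>2 * (LINT z|arclength. (norm (u z))\<^sup>2) + 2 * (norm b)\<^sup>2 * (LINT z|arclength. (norm (v z))\<^sup>2)"
proof -
  let ?B = "\<lambda>z. 2 * (norm a)\<^sup>2 * (norm (u z))\<^sup>2 + 2 * (norm b)\<^sup>2 * (norm (v z))\<^sup>2"
  have [measurable]: "u \<in> borel_measurable arclength" "v \<in> borel_measurable arclength"
    using assms by (auto simp: square_integrable_def)
  have B: "integrable arclength ?B"
    using assms by (auto simp: square_integrable_def)
  have i: "integrable arclength (\<lambda>z. (norm (a * u z + b * v z))\<^sup>2)"
    by (rule Bochner_Integration.integrable_bound[OF B]) (auto intro!: AE_I2 order_trans[OF norm_linear_power2_le])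
  then show "square_integrable (\<lambda>z. a * u z + b * v z)" by (simp add: square_integrable_def)
  have "(LINT z|arclength. (norm (a * u z + b * v z))\<^sup>2) \<le> (LINT z|arclength. ?B z)"
    by (intro integral_mono i B norm_linear_power2_le)
  also have "\<dots> = 2 * (norm a)\<^sup>2 * (LINT z|arclength. (norm (u z))\<^sup>2) + 2 * (norm b)\<^sup>2 * (LINT z|arclength. (norm (v z))\<^sup>2)"
    using assms by (subst Bochner_Integration.integral_add) (auto simp: square_integrable_def)
  finally show "(LINT z|arclength. (norm (a * u z + b * v z))\<^sup>2) \<le>
       2 * (norm a)\<^sup>2 * (LINT z|arclength. (norm (u z))\<^sup>2) + 2 * (norm b)\<^sup>2 * (LINT z|arclength. (norm (v z))\<^sup>2)" .
qed

lemma square_integrable_trig_poly: "trig_poly p \<Longrightarrow> square_integrable p"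
  using trig_poly_bounded_measurable square_integrable_bounded by blast

text \<open>The closure of the trigonometric polynomials in \<open>L\<^sup>2\<close>. Square
  integrability is included because the integral of a function that is not integrable is 0, which
  would make the approximation condition hold for the wrong reason.\<close>

definition trig_approx :: "(complex \<Rightarrow> complex) \<Rightarrow> bool" where
  "trig_approx u \<longleftrightarrow> square_integrable u \<and>
     (\<forall>\<epsilon>>0. \<exists>p. trig_poly p \<and> (LINT z|arclength. (norm (u z - p z))\<^sup>2) < \<epsilon>)"

lemma trig_approx_linear:
  assumes u: "trig_approx u" and v: "trig_approx v"
  shows "trig_approx (\<lambda>z. a * u z + b * v z)"
  unfolding trig_approx_def
proof (intro conjI allI impI)
  show "square_integrable (\<lambda>z. a * u z + b * v z)"
    using u v by (auto intro: square_integrable_linear(1) simp: trig_approx_def)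
  fix \<epsilon> :: real assume "\<epsilon> > 0"
  \<comment> \<open>The denominator is the constant of \<open>square_integrable_linear\<close>,
    increased by 1 to keep it positive when a = b = 0.\<close>
  define \<delta> where "\<delta> = \<epsilon> / (2 * (norm a)\<^sup>2 + 2 * (norm b)\<^sup>2 + 1)"
  have den: "2 * (norm a)\<^sup>2 + 2 * (norm b)\<^sup>2 + 1 > 0" by (intro add_nonneg_pos) auto
  then have "\<delta> > 0" using \<open>\<epsilon> > 0\<close> by (simp add: \<delta>_def)
  obtain p q where p: "trig_poly p" "(LINT z|arclength. (norm (u z - p z))\<^sup>2) < \<delta>"
    and q: "trig_poly q" "(LINT z|arclength. (norm (v z - q z))\<^sup>2) < \<delta>"
    using u v \<open>\<delta> > 0\<close> unfolding trig_approx_def by blast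
  have sp: "square_integrable (\<lambda>z. u z - p z)"
    using square_integrable_linear(1)[of u p 1 "-1"] u square_integrable_trig_poly[OF p(1)] by (simp add: trig_approx_def)
  have sq: "square_integrable (\<lambda>z. v z - q z)"
    using square_integrable_linear(1)[of v q 1 "-1"] v square_integrable_trig_poly[OF q(1)] by (simp add: trig_approx_def)
  have "trig_poly (\<lambda>z. a * p z + b * q z)"
    by (intro trig_poly_add trig_poly_mult trig_poly_const p q)
  moreover have "(LINT z|arclength. (norm (a * u z + b * v z - (a * p z + b * q z)))\<^sup>2) < \<epsilon>"
  proof -
    have "(LINT z|arclength. (norm (a * u z + b * v z - (a * p z + b * q z)))\<^sup>2)
      = (LINT z|arclength. (norm (a * (u z - p z) + b * (v z - q z)))\<^sup>2)"
      by (simp add: algebra_simps)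
    also have "\<dots> \<le> 2 * (norm a)\<^sup>2 * (LINT z|arclength. (norm (u z - p z))\<^sup>2) + 2 * (norm b)\<^sup>2 * (LINT z|arclength. (norm (v z - q z))\<^sup>2)"
      by (rule square_integrable_linear(2)[OF sp sq])
    also have "\<dots> \<le> 2 * (norm a)\<^sup>2 * \<delta> + 2 * (norm b)\<^sup>2 * \<delta>"
      using p(2) q(2) by (intro add_mono mult_left_mono) auto
    also have "\<dots> < (2 * (norm a)\<^sup>2 + 2 * (norm b)\<^sup>2 + 1) * \<delta>"
      using \<open>\<delta> > 0\<close> by (simp add: algebra_simps)
    also have "\<dots> = \<epsilon>" using den by (simp add: \<delta>_def)
    finally show ?thesis .
  qed
  ultimately show "\<exists>p. trig_poly p \<and> (LINT z|arclength. (norm (a * u z + b * v z - p z))\<^sup>2) < \<epsilon>" by blast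
qed

lemma trig_approx_trig_poly: "trig_poly p \<Longrightarrow> trig_approx p"
  unfolding trig_approx_def using square_integrable_trig_poly by (auto intro!: exI[of _ p])

lemma trig_approx_cmult: "trig_approx u \<Longrightarrow> trig_approx (\<lambda>z. c * u z)"
  using trig_approx_linear[of u u c 0] by simp

lemma trig_approx_sum: "finite A \<Longrightarrow> (\<And>i. i \<in> A \<Longrightarrow> trig_approx (u i)) \<Longrightarrow> trig_approx (\<lambda>z. \<Sum>i\<in>A. u i z)"
proof (induction A rule: finite_induct)
  case empty
  show ?case using trig_approx_trig_poly[OF trig_poly_const[of 0]] by simp
next
  case (insert i A)
  then show ?case using trig_approx_linear[of "u i" "\<lambda>z. \<Sum>i\<in>A. u i z" 1 1] by simp
qed

lemma trig_approx_cong: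
  assumes "trig_approx v" "\<And>z. z \<in> circle \<Longrightarrow> u z = v z"
  shows "trig_approx u"
proof -
  have "(LINT z|arclength. (norm (u z - p z))\<^sup>2) = (LINT z|arclength. (norm (v z - p z))\<^sup>2)" for p
    using assms(2) by (intro Bochner_Integration.integral_cong) (auto simp: space_arclength)
  moreover have "square_integrable u \<longleftrightarrow> square_integrable v"
    unfolding square_integrable_def using assms(2)
    by (intro conj_cong measurable_cong Bochner_Integration.integrable_cong) (auto simp: space_arclength)
  ultimately show ?thesis using assms(1) by (simp add: trig_approx_def)
qed

text \<open>Dominated pointwise limits are limits in \<open>L\<^sup>2\<close>, with majorant
  \<open>4 w\<^sup>2\<close> for the squared differences. This one closure property leads from
  polynomials to continuous functions, to indicators and to all square integrable functions.\<close>

lemma trig_approx_limit: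
  assumes u: "\<And>k. trig_approx (u k)" and w: "integrable arclength (\<lambda>z. (w z)\<^sup>2)"
    and bound: "\<And>k z. z \<in> circle \<Longrightarrow> norm (u k z) \<le> w z"
    and lim: "\<And>z. z \<in> circle \<Longrightarrow> (\<lambda>k. u k z) \<longlonglongrightarrow> v z"
  shows "trig_approx v"
  unfolding trig_approx_def
proof (intro conjI allI impI)
  have um: "u k \<in> borel_measurable arclength" and us: "square_integrable (u k)" for k
    using u[of k] by (auto simp: trig_approx_def square_integrable_def)
  have vm: "v \<in> borel_measurable arclength"
    by (rule borel_measurable_LIMSEQ_metric[where f = u, OF um]) (simp add: lim space_arclength)
  have vb: "norm (v z) \<le> w z" if "z \<in> circle" for z
    using bound[OF that] by (intro LIMSEQ_le_const2[OF tendsto_norm[OF lim[OF that]]]) auto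
  have "integrable arclength (\<lambda>z. (norm (v z))\<^sup>2)"
    by (rule Bochner_Integration.integrable_bound[OF w])
      (use vm vb in \<open>auto simp: space_arclength intro!: AE_I2 power_mono\<close>)
  then show vs: "square_integrable v" using vm by (simp add: square_integrable_def)
  fix \<epsilon> :: real assume "\<epsilon> > 0"
  have "(\<lambda>k. LINT z|arclength. (norm (v z - u k z))\<^sup>2) \<longlonglongrightarrow> (LINT z|arclength. 0)"
  proof (rule integral_dominated_convergence[where w = "\<lambda>z. 4 * (w z)\<^sup>2"])
    show "AE z in arclength. (\<lambda>k. (norm (v z - u k z))\<^sup>2) \<longlonglongrightarrow> 0"
    proof (rule AE_I2)
      fix z assume "z \<in> space arclength"
      then have "(\<lambda>k. (norm (v z - u k z))\<^sup>2) \<longlonglongrightarrow> (norm (v z - v z))\<^sup>2"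
        by (intro tendsto_intros lim) (simp add: space_arclength)
      then show "(\<lambda>k. (norm (v z - u k z))\<^sup>2) \<longlonglongrightarrow> 0" by simp
    qed
    show "AE z in arclength. norm ((norm (v z - u k z))\<^sup>2) \<le> 4 * (w z)\<^sup>2" for k
    proof (rule AE_I2)
      fix z assume "z \<in> space arclength"
      then have "norm (v z - u k z) \<le> 2 * w z"
        using norm_triangle_ineq4[of "v z" "u k z"] vb[of z] bound[of z k] by (simp add: space_arclength)
      from power_mono[OF this, of 2] show "norm ((norm (v z - u k z))\<^sup>2) \<le> 4 * (w z)\<^sup>2"
        by (simp add: power_mult_distrib)
    qed
  qed (use vm um w in auto)
  then have "(\<lambda>k. LINT z|arclength. (norm (v z - u k z))\<^sup>2) \<longlonglongrightarrow> 0" by simp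
  \<comment> \<open>A quarter of \<epsilon> for each of the two errors, because the square of a sum
    costs a factor 2.\<close>
  then have "\<forall>\<^sub>F k in sequentially. (LINT z|arclength. (norm (v z - u k z))\<^sup>2) < \<epsilon> / 4"
    by (rule order_tendstoD(2)) (use \<open>\<epsilon> > 0\<close> in simp)
  then obtain k where k: "(LINT z|arclength. (norm (v z - u k z))\<^sup>2) < \<epsilon> / 4"
    by (auto simp: eventually_sequentially)
  have "\<epsilon> / 4 > 0" using \<open>\<epsilon> > 0\<close> by simp
  then obtain p where p: "trig_poly p" "(LINT z|arclength. (norm (u k z - p z))\<^sup>2) < \<epsilon> / 4"
    using u[of k] unfolding trig_approx_def by blast
  have s1: "square_integrable (\<lambda>z. v z - u k z)"
    using square_integrable_linear(1)[OF vs us[of k], of 1 "-1"] by simp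
  have s2: "square_integrable (\<lambda>z. u k z - p z)"
    using square_integrable_linear(1)[OF us[of k] square_integrable_trig_poly[OF p(1)], of 1 "-1"] by simp
  have "(LINT z|arclength. (norm (v z - p z))\<^sup>2) < \<epsilon>"
    using square_integrable_linear(2)[OF s1 s2, of 1 1] k p(2) by simp
  then show "\<exists>p. trig_poly p \<and> (LINT z|arclength. (norm (v z - p z))\<^sup>2) < \<epsilon>" using p(1) by blast
qed

lemma trig_approx_continuous:
  fixes g :: "complex \<Rightarrow> real"
  assumes "continuous_on circle g"
  shows "trig_approx (\<lambda>z. of_real (g z))"
proof -
  have "\<forall>k. \<exists>p. real_polynomial_function p \<and> (\<forall>z\<in>circle. \<bar>g z - p z\<bar> < 1 / real (Suc k))"
  proof
    fix k
    have "0 < 1 / real (Suc k)" by simp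
    show "\<exists>p. real_polynomial_function p \<and> (\<forall>z\<in>circle. \<bar>g z - p z\<bar> < 1 / real (Suc k))"
      by (rule Stone_Weierstrass_real_polynomial_function[OF compact_sphere assms \<open>0 < 1 / real (Suc k)\<close>])
        (intro exI conjI ballI)
  qed
  from choice[OF this] obtain p
    where p_all: "\<forall>k. real_polynomial_function (p k) \<and> (\<forall>z\<in>circle. \<bar>g z - p k z\<bar> < 1 / real (Suc k))" ..
  have p: "real_polynomial_function (p k)" "z \<in> circle \<Longrightarrow> \<bar>g z - p k z\<bar> < 1 / real (Suc k)" for k z
    using p_all by auto
  obtain B where B: "\<forall>z\<in>circle. \<bar>g z\<bar> \<le> B"
    using compact_imp_bounded[OF compact_continuous_image[OF assms compact_sphere]]
    unfolding bounded_iff by auto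
  show ?thesis
  proof (rule trig_approx_limit[where w = "\<lambda>_. B + 1" and u = "\<lambda>k z. of_real (p k z)"])
    show "trig_approx (\<lambda>z. of_real (p k z))" for k
      by (intro trig_approx_trig_poly trig_poly_real_polynomial p)
    show "norm (complex_of_real (p k z)) \<le> B + 1" if "z \<in> circle" for k z
    proof -
      have "1 / real (Suc k) \<le> 1" by simp
      then show ?thesis using p(2)[OF that, of k] bspec[OF B that] by (simp only: norm_of_real)
    qed
    show "(\<lambda>k. complex_of_real (p k z)) \<longlonglongrightarrow> of_real (g z)" if "z \<in> circle" for z
    proof -
      have "(\<lambda>k. g z - p k z) \<longlonglongrightarrow> 0"
        by (rule LIMSEQ_norm_0) (use p(2)[OF that] in \<open>simp only: real_norm_def\<close>)
      then have "(\<lambda>k. complex_of_real (g z - (g z - p k z))) \<longlonglongrightarrow> of_real (g z - 0)"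
        by (intro tendsto_intros)
      then show ?thesis by simp
    qed
  qed simp
qed

text \<open>Dynkin's theorem, starting from the closed sets, which generate the Borel sets and are
  stable under intersection. The indicator of a closed set is the limit of the continuous cut-offs
  \<open>max 0 (1 - k * infdist z F)\<close>.\<close>

lemma trig_approx_indicator:
  assumes "A \<in> sets borel"
  shows "trig_approx (\<lambda>z. indicator A z)"
proof -
  have A: "A \<in> sigma_sets UNIV {F. closed F}"
    using assms by (simp add: borel_eq_closed)
  have stable: "Int_stable {F :: complex set. closed F}" by (auto simp: Int_stable_def)
  have sub: "{F :: complex set. closed F} \<subseteq> Pow UNIV" by simp
  show ?thesis
    using stable sub A
  proof (induction rule: sigma_sets_induct_disjoint)
    case (basic F)
    then have F: "closed F" by simp
    show ?case
    \<comment> \<open>By convention \<open>infdist z {} = 0\<close>, so the cut-offs would be 1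
      everywhere for the empty set.\<close>
    proof (cases "F = {}")
      case True
      then show ?thesis using trig_approx_trig_poly[OF trig_poly_const[of 0]] by simp
    next
      case False
      let ?u = "\<lambda>k z. max 0 (1 - real k * infdist z F)"
      show ?thesis
      proof (rule trig_approx_limit[where w = "\<lambda>_. 1" and u = "\<lambda>k z. of_real (?u k z)"])
        show "trig_approx (\<lambda>z. of_real (?u k z))" for k
          by (intro trig_approx_continuous continuous_intros)
        show "norm (complex_of_real (?u k z)) \<le> 1" for k z
          by (simp only: norm_of_real) (auto simp: max_def infdist_nonneg)
        show "(\<lambda>k. complex_of_real (?u k z)) \<longlonglongrightarrow> indicator F z" for z
        proof (cases "z \<in> F")
          case True
          then show ?thesis by simp
        next
          case z: False
          then have d: "infdist z F > 0" using F False by (simp add: infdist_pos_not_in_closed)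
          have "\<forall>\<^sub>F k in sequentially. 1 / infdist z F \<le> real k"
            by (rule eventually_sequentiallyI[of "nat \<lceil>1 / infdist z F\<rceil>"]) linarith
          then have "\<forall>\<^sub>F k in sequentially. complex_of_real (?u k z) = indicator F z"
            by eventually_elim (use z d in \<open>auto simp: max_def field_simps\<close>)
          then show ?thesis by (rule tendsto_eventually)
        qed
      qed simp
    qed
  next
    case empty
    then show ?case using trig_approx_trig_poly[OF trig_poly_const[of 0]] by simp
  next
    case (compl A)
    have "trig_approx (\<lambda>z. 1 * 1 + (- 1) * indicator A z)"
      by (intro trig_approx_linear compl trig_approx_trig_poly trig_poly_const)
    then show ?case by (rule trig_approx_cong) (simp add: indicator_def)
  next
    case (union A)
    let ?u = "\<lambda>k z. \<Sum>i<k. indicator (A i) z :: complex"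
    have u: "?u k z = indicator (\<Union>i<k. A i) z" for k z
      using union(1) by (simp add: indicator_UN_disjoint disjoint_family_on_mono[of _ UNIV])
    show ?case
    proof (rule trig_approx_limit[where w = "\<lambda>_. 1" and u = ?u])
      show "trig_approx (?u k)" for k using union(3) by (intro trig_approx_sum) auto
      show "norm (?u k z) \<le> 1" for k z unfolding u by (simp add: indicator_def)
      show "(\<lambda>k. ?u k z) \<longlonglongrightarrow> indicator (\<Union>i. A i) z" for z
        unfolding u by (rule LIMSEQ_indicator_UN)
    qed simp
  qed
qed

lemma trig_approx_square_integrable:
  assumes u: "square_integrable u"
  shows "trig_approx u"
proof -
  have um: "u \<in> borel_measurable arclength" using u by (simp add: square_integrable_def)
  obtain s where s: "\<And>k. simple_function arclength (s k)"
    and lim: "\<And>z. z \<in> circle \<Longrightarrow> (\<lambda>k. s k z) \<longlonglongrightarrow> u z"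
    and le: "\<And>k z. z \<in> circle \<Longrightarrow> norm (s k z) \<le> 2 * norm (u z)"
    using borel_measurable_implies_sequence_metric[OF um, of 0] unfolding space_arclength dist_0_norm[symmetric] dist_commute[of 0]
    by blast
  show ?thesis
  proof (rule trig_approx_limit[where u = s and w = "\<lambda>z. 2 * norm (u z)"])
    show "trig_approx (s k)" for k
    proof -
      have fin: "finite (s k ` circle)" using simple_functionD(1)[OF s[of k]] by (simp add: space_arclength)
      \<comment> \<open>The level set is controlled only inside the circle; it is replaced by a
        Borel set of the plane with the same trace on the circle.\<close>
      have ind: "trig_approx (\<lambda>z. indicator (s k -` {y}) z)" for y
      proof -
        have "s k -` {y} \<inter> circle \<in> sets arclength"
          using simple_functionD(2)[OF s[of k], of "{y}"] by (simp add: space_arclength)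
        then obtain B where B: "B \<in> sets borel" "s k -` {y} \<inter> circle = circle \<inter> B"
          unfolding sets_arclength sets_restrict_space by blast
        show ?thesis
        proof (rule trig_approx_cong[OF trig_approx_indicator[OF B(1)]])
          fix z assume "z \<in> circle"
          then have "z \<in> s k -` {y} \<longleftrightarrow> z \<in> B" using B(2) by blast
          then show "indicator (s k -` {y}) z = (indicator B z :: complex)" by (simp only: indicator_def)
        qed
      qed
      have "trig_approx (\<lambda>z. \<Sum>y\<in>s k ` circle. y * indicator (s k -` {y}) z)"
        by (rule trig_approx_sum[OF fin]) (rule trig_approx_cmult[OF ind])
      moreover have "s k z = (\<Sum>y\<in>s k ` circle. y * indicator (s k -` {y}) z)" if "z \<in> circle" for z
      proof -
        have "(\<Sum>y\<in>s k ` circle. y * indicator (s k -` {y}) z) = (\<Sum>y\<in>s k ` circle. if s k z = y then y else 0)"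
          by (intro sum.cong) (auto simp: indicator_def)
        then show ?thesis using that fin by simp
      qed
      ultimately show ?thesis by (rule trig_approx_cong)
    qed
    show "integrable arclength (\<lambda>z. (2 * norm (u z))\<^sup>2)"
      using u by (simp add: square_integrable_def power_mult_distrib)
  qed (rule le lim, assumption)+
qed

section \<open>Best approximation and the completeness half of Parseval\<close>

text \<open>Completing the square: among the trigonometric polynomials with frequencies in \<open>F\<close> the
  Fourier partial sum is the best approximation.\<close>

lemma integral_norm_diff_trig_poly_ge:
  assumes u: "square_integrable u" and F: "finite F"
  shows "(LINT z|arclength. (norm (u z))\<^sup>2) - 2 * pi * (\<Sum>n\<in>F. (norm (fourier_coeff u n))\<^sup>2)
    \<le> (LINT z|arclength. (norm (u z - (\<Sum>n\<in>F. c n * z powi n)))\<^sup>2)"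
proof -
  let ?p = "\<lambda>z. \<Sum>n\<in>F. c n * z powi n"
  have ui: "integrable arclength u"
    by (rule integrable_of_square_integrable'[OF u])
  have tp: "trig_poly ?p" unfolding trig_poly_def using F by blast
  have pi: "integrable arclength ?p"
    by (rule integrable_of_square_integrable'[OF square_integrable_trig_poly[OF tp]])
  have pp: "integrable arclength (\<lambda>z. (norm (?p z))\<^sup>2)"
    using square_integrable_trig_poly[OF tp] by (simp add: square_integrable_def)
  have cnj_p: "cnj (?p z) = (\<Sum>n\<in>F. cnj (c n) * z powi (- n))" if "z \<in> circle" for z
    using that by (simp add: cnj_powi_circle)
  have up_i: "integrable arclength (\<lambda>z. \<Sum>n\<in>F. cnj (c n) * (u z * z powi (- n)))"
    by (intro Bochner_Integration.integrable_sum integrable_mult_right integrable_mult_powi ui)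
  have fc: "(LINT z|arclength. u z * z powi (- n)) = 2 * pi * fourier_coeff u n" for n
    by (simp add: fourier_coeff_powi)
  have up: "(LINT z|arclength. (\<Sum>n\<in>F. cnj (c n) * (u z * z powi (- n)))) = (\<Sum>n\<in>F. 2 * pi * (cnj (c n) * fourier_coeff u n))"
  proof -
    have "(LINT z|arclength. (\<Sum>n\<in>F. cnj (c n) * (u z * z powi (- n)))) = (\<Sum>n\<in>F. LINT z|arclength. cnj (c n) * (u z * z powi (- n)))"
      by (intro Bochner_Integration.integral_sum integrable_mult_right integrable_mult_powi ui)
    also have "\<dots> = (\<Sum>n\<in>F. cnj (c n) * (2 * pi * fourier_coeff u n))"
      by (simp only: integral_mult_right_zero fc)
    also have "\<dots> = (\<Sum>n\<in>F. 2 * pi * (cnj (c n) * fourier_coeff u n))"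
      by (intro sum.cong) auto
    finally show ?thesis .
  qed
  have coeff_p: "(LINT z|arclength. ?p z * z powi (- n)) = 2 * pi * c n" if "n \<in> F" for n
  proof -
    have "(LINT z|arclength. ?p z * z powi (- n)) = (LINT z|arclength. (\<Sum>m\<in>F. c m * z powi (m - n)))"
    proof (intro Bochner_Integration.integral_cong refl)
      fix z assume "z \<in> space arclength"
      then have "z \<noteq> 0" by (auto simp: space_arclength)
      then show "?p z * z powi (- n) = (\<Sum>m\<in>F. c m * z powi (m - n))"
        by (simp add: sum_distrib_right power_int_diff power_int_minus divide_inverse mult.assoc)
    qed
    also have "\<dots> = (\<Sum>m\<in>F. c m * (if m - n = 0 then 2 * pi else 0))"
      unfolding integral_powi_arclength[symmetric] integral_mult_right_zero[symmetric]
      by (intro Bochner_Integration.integral_sum integrable_mult_right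
        arclength.integrable_bounded_circle[of _ 1] arclength.measurable_powi) (simp only: norm_powi_circle)
    also have "\<dots> = (\<Sum>m\<in>F. if n = m then 2 * pi * c m else 0)"
      by (intro sum.cong) auto
    also have "\<dots> = 2 * pi * c n" using that F by simp
    finally show ?thesis .
  qed
  have pp_int: "(LINT z|arclength. (norm (?p z))\<^sup>2) = 2 * pi * (\<Sum>n\<in>F. (norm (c n))\<^sup>2)"
  proof -
    have "of_real (LINT z|arclength. (norm (?p z))\<^sup>2) = (LINT z|arclength. complex_of_real ((norm (?p z))\<^sup>2))"
      by (rule integral_complex_of_real[symmetric])
    also have "\<dots> = (LINT z|arclength. (\<Sum>n\<in>F. cnj (c n) * (?p z * z powi (- n))))"
      by (intro Bochner_Integration.integral_cong refl, subst complex_norm_square, subst cnj_p)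
        (simp_all add: space_arclength sum_distrib_left mult.left_commute)
    also have "\<dots> = (\<Sum>n\<in>F. cnj (c n) * (LINT z|arclength. ?p z * z powi (- n)))"
      unfolding integral_mult_right_zero[symmetric]
      by (intro Bochner_Integration.integral_sum integrable_mult_right integrable_mult_powi pi)
    also have "\<dots> = (\<Sum>n\<in>F. of_real (2 * pi * (norm (c n))\<^sup>2))"
    proof (intro sum.cong refl)
      fix n assume "n \<in> F"
      then show "cnj (c n) * (LINT z|arclength. ?p z * z powi (- n)) = of_real (2 * pi * (norm (c n))\<^sup>2)"
        unfolding of_real_mult complex_norm_square by (subst coeff_p) (simp_all add: ac_simps)
    qed
    also have "\<dots> = of_real (2 * pi * (\<Sum>n\<in>F. (norm (c n))\<^sup>2))"
      by (simp only: sum_distrib_left of_real_sum)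
    finally show ?thesis by (simp only: of_real_eq_iff)
  qed
  have "(norm (u z - ?p z))\<^sup>2 = (norm (u z))\<^sup>2 - 2 * Re (\<Sum>n\<in>F. cnj (c n) * (u z * z powi (- n))) + (norm (?p z))\<^sup>2"
    if "z \<in> circle" for z
  proof -
    have *: "(norm (x - y))\<^sup>2 = (norm x)\<^sup>2 - 2 * Re (x * cnj y) + (norm y)\<^sup>2" for x y
      unfolding cmod_power2 by (simp add: power2_eq_square algebra_simps)
    have "u z * cnj (?p z) = (\<Sum>n\<in>F. cnj (c n) * (u z * z powi (- n)))"
      unfolding cnj_p[OF that] sum_distrib_left by (simp only: mult.left_commute)
    then show ?thesis by (simp only: *)
  qed
  then have "(LINT z|arclength. (norm (u z - ?p z))\<^sup>2)
    = (LINT z|arclength. (norm (u z))\<^sup>2 - 2 * Re (\<Sum>n\<in>F. cnj (c n) * (u z * z powi (- n))) + (norm (?p z))\<^sup>2)"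
    by (intro Bochner_Integration.integral_cong refl) (simp add: space_arclength)
  also have "\<dots> = (LINT z|arclength. (norm (u z))\<^sup>2) - 2 * (LINT z|arclength. Re (\<Sum>n\<in>F. cnj (c n) * (u z * z powi (- n))))
      + (LINT z|arclength. (norm (?p z))\<^sup>2)"
  proof -
    note i1 = u[unfolded square_integrable_def, THEN conjunct2]
    note i2 = integrable_mult_right[OF integrable_Re[OF up_i], of 2]
    show ?thesis
      unfolding Bochner_Integration.integral_add[OF Bochner_Integration.integrable_diff[OF i1 i2] pp]
        Bochner_Integration.integral_diff[OF i1 i2] integral_mult_right_zero ..
  qed
  also have "(LINT z|arclength. Re (\<Sum>n\<in>F. cnj (c n) * (u z * z powi (- n)))) = (\<Sum>n\<in>F. 2 * pi * Re (cnj (c n) * fourier_coeff u n))"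
    unfolding integral_Re[OF up_i] up by (simp add: Re_sum mult.assoc)
  finally have eq: "(LINT z|arclength. (norm (u z - ?p z))\<^sup>2) = (LINT z|arclength. (norm (u z))\<^sup>2)
      - 2 * (\<Sum>n\<in>F. 2 * pi * Re (cnj (c n) * fourier_coeff u n)) + (LINT z|arclength. (norm (?p z))\<^sup>2)" .
  \<comment> \<open>Twice this bound is subtracted in \<open>eq\<close>, so its part with
    \<open>c n\<close> cancels against the integral of \<open>|p|\<^sup>2\<close>.\<close>
  have "(\<Sum>n\<in>F. 2 * pi * Re (cnj (c n) * fourier_coeff u n))
    \<le> pi * (\<Sum>n\<in>F. (norm (fourier_coeff u n))\<^sup>2) + pi * (\<Sum>n\<in>F. (norm (c n))\<^sup>2)"
  proof -
    have "2 * Re (cnj x * y) \<le> (norm y)\<^sup>2 + (norm x)\<^sup>2" for x y :: complex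
      using complex_Re_le_cmod[of "cnj x * y"] sum_squares_bound[of "norm x" "norm y"] by (simp add: norm_mult)
    from mult_left_mono[OF this, of pi]
    have "2 * pi * Re (cnj x * y) \<le> pi * (norm y)\<^sup>2 + pi * (norm x)\<^sup>2" for x y :: complex
      by (simp add: algebra_simps)
    then show ?thesis unfolding sum_distrib_left sum.distrib[symmetric] by (intro sum_mono)
  qed
  then show ?thesis unfolding eq pp_int by linarith
qed

text \<open>Completeness of the exponentials: for a trigonometric polynomial within \<epsilon> of
  \<open>u\<close>, the preceding lower bound shows that the frequencies of this polynomial alone
  account for the integral up to \<epsilon>.\<close>

lemma parseval_le:
  assumes u: "square_integrable u" and s: "(\<lambda>n. (norm (fourier_coeff u n))\<^sup>2) summable_on UNIV"
  shows "(LINT z|arclength. (norm (u z))\<^sup>2) \<le> 2 * pi * (\<Sum>\<^sub>\<infinity>n. (norm (fourier_coeff u n))\<^sup>2)"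
proof (rule field_le_epsilon)
  fix \<epsilon> :: real assume "\<epsilon> > 0"
  then obtain p where p: "trig_poly p" "(LINT z|arclength. (norm (u z - p z))\<^sup>2) < \<epsilon>"
    using trig_approx_square_integrable[OF u] unfolding trig_approx_def by blast
  then obtain F c where F: "finite F" "\<And>z. z \<in> circle \<Longrightarrow> p z = (\<Sum>n\<in>F. c n * z powi n)"
    unfolding trig_poly_def by blast
  have "(LINT z|arclength. (norm (u z - p z))\<^sup>2) = (LINT z|arclength. (norm (u z - (\<Sum>n\<in>F. c n * z powi n)))\<^sup>2)"
    using F(2) by (intro Bochner_Integration.integral_cong) (auto simp: space_arclength)
  then have "(LINT z|arclength. (norm (u z))\<^sup>2) \<le> 2 * pi * (\<Sum>n\<in>F. (norm (fourier_coeff u n))\<^sup>2) + \<epsilon>"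
    using integral_norm_diff_trig_poly_ge[OF u F(1), of c] p(2) by linarith
  moreover have "2 * pi * (\<Sum>n\<in>F. (norm (fourier_coeff u n))\<^sup>2) \<le> 2 * pi * (\<Sum>\<^sub>\<infinity>n. (norm (fourier_coeff u n))\<^sup>2)"
    by (rule mult_left_mono[OF finite_sum_le_infsum[OF s F(1)]]) auto
  ultimately show "(LINT z|arclength. (norm (u z))\<^sup>2) \<le> 2 * pi * (\<Sum>\<^sub>\<infinity>n. (norm (fourier_coeff u n))\<^sup>2) + \<epsilon>"
    by linarith
qed

lemma integral_norm_le_dirichlet_norm:
  assumes u: "u \<in> dirichlet_space"
  shows "(LINT z|arclength. (norm (u z))\<^sup>2) \<le> 2 * pi * (dirichlet_norm u)\<^sup>2"
proof -
  let ?D = "\<lambda>n::int. (1 + \<bar>of_int n\<bar>) * (norm (fourier_coeff u n))\<^sup>2 :: real"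
  have le: "(norm (fourier_coeff u n))\<^sup>2 \<le> ?D n" for n
    by (simp add: algebra_simps)
  have s: "(\<lambda>n. (norm (fourier_coeff u n))\<^sup>2) summable_on UNIV"
    by (rule summable_on_comparison_test[OF dirichlet_spaceD(4)[OF u] le]) simp
  have "(LINT z|arclength. (norm (u z))\<^sup>2) \<le> 2 * pi * (\<Sum>\<^sub>\<infinity>n. (norm (fourier_coeff u n))\<^sup>2)"
    using dirichlet_spaceD(1,2)[OF u] by (intro parseval_le s) (simp add: square_integrable_def)
  also have "\<dots> \<le> 2 * pi * infsum ?D UNIV"
    by (intro mult_left_mono infsum_mono s dirichlet_spaceD(4) u le) simp
  also have "infsum ?D UNIV = (dirichlet_norm u)\<^sup>2"
    by (simp add: dirichlet_norm_def infsum_nonneg)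
  finally show ?thesis .
qed

subsection \<open>Szego's inequality\<close>

lemma integral_arclength_cong:
  fixes f g :: "complex \<Rightarrow> real"
  assumes "integrable arclength g" "\<And>z. z \<in> space arclength \<Longrightarrow> f z = g z"
  shows "integrable arclength f \<and> (LINT z|arclength. f z) = (LINT z|arclength. g z)"
proof
  show "integrable arclength f"
    by (rule Bochner_Integration.integrable_cong[OF refl assms(2), THEN iffD2, OF _ assms(1)])
  show "(LINT z|arclength. f z) = (LINT z|arclength. g z)"
    by (rule Bochner_Integration.integral_cong[OF refl assms(2)])
qed

text \<open>The mean value property of a harmonic function with value 0 at the centre:
  \<open>Ln (1 - b z)\<close> is a power series without constant term, and every positive power of z
  has integral 0.\<close>

lemma integral_log_one_minus:
  assumes b: "norm b < 1"
  shows "integrable arclength (\<lambda>z. ln (norm (1 - b * z)))" "(LINT z|arclength. ln (norm (1 - b * z))) = 0"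
proof -
  let ?F = "\<lambda>n z. (b * z) ^ n / of_nat n"
  let ?S = "\<lambda>z. - Ln (1 - b * z)"
  have nz: "norm (b * z) < 1" if "z \<in> circle" for z using that b by (simp add: norm_mult)
  have ne: "1 - b * z \<noteq> 0" if "z \<in> circle" for z using nz[OF that] by auto
  have F0: "(LINT z|arclength. ?F n z) = 0" for n
  \<comment> \<open>The power itself would have integral 2 pi at n = 0, but there the division by
    zero makes the term 0.\<close>
  proof (cases "n = 0")
    case False
    have "(LINT z|arclength. ?F n z) = (LINT z|arclength. (b ^ n / of_nat n) * z powi int n)"
      by (simp add: power_mult_distrib)
    also have "\<dots> = (b ^ n / of_nat n) * (LINT z|arclength. z powi int n)"
      by (rule integral_mult_right_zero)
    also have "\<dots> = 0" using False by (simp add: integral_powi_arclength del: power_int_of_nat)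
    finally show ?thesis .
  qed simp
  have *: "integrable arclength ?S" "((\<lambda>n. LINT z|arclength. ?F n z) has_sum (LINT z|arclength. ?S z)) UNIV"
  proof -
    have sf: "sigma_finite_measure arclength" by unfold_locales
    have s: "(\<lambda>n. norm b ^ n) summable_on UNIV"
      using b by (intro norm_summable_imp_summable_on) (simp add: power_abs)
    have m: "?F n \<in> borel_measurable arclength" for n
      by (rule arclength.measurable_circle) measurable
    have bound: "norm (?F n z) \<le> norm b ^ n * 1" if "z \<in> space arclength" for n z
      using that divide_nat_le[of "norm b ^ n" n] by (simp add: space_arclength norm_divide norm_power norm_mult)
    have i1: "integrable arclength (\<lambda>_. 1::real)" by simp
    have S: "((\<lambda>n. ?F n z) has_sum ?S z) UNIV" if "z \<in> space arclength" for z
      using that by (intro log_series_has_sum nz) (simp only: space_arclength)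
    note h = has_sum_integral[where M = arclength and F = ?F and b = "\<lambda>n. norm b ^ n" and g = "\<lambda>_. 1" and S = ?S,
      OF sf m s zero_le_power[OF norm_ge_zero] i1 bound S]
    show "integrable arclength ?S" by (rule h(1))
    show "((\<lambda>n. LINT z|arclength. ?F n z) has_sum (LINT z|arclength. ?S z)) UNIV" by (rule h(2))
  qed
  have eq: "ln (norm (1 - b * z)) = - Re (?S z)" if "z \<in> circle" for z
    using ne[OF that] by simp
  have "integrable arclength (\<lambda>z. - Re (?S z))"
    using integrable_Re[OF *(1)] by (rule Bochner_Integration.integrable_minus)
  then show "integrable arclength (\<lambda>z. ln (norm (1 - b * z)))"
    by (subst Bochner_Integration.integrable_cong[OF refl eq]) (simp only: space_arclength)
  have "(LINT z|arclength. ?S z) = 0"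
    using infsumI[OF *(2)] unfolding F0 by simp
  then have "(LINT z|arclength. - Re (?S z)) = 0"
    unfolding integral_minus integral_Re[OF *(1)] by simp
  then show "(LINT z|arclength. ln (norm (1 - b * z))) = 0"
    by (subst Bochner_Integration.integral_cong[OF refl eq]) (simp only: space_arclength)
qed

lemma measure_arclength: "measure arclength circle = 2 * pi"
  using emeasure_arclength by (simp add: measure_def)

text \<open>Jensen's formula for one zero. If |a| < 1, then \<open>|z - a| = |1 - (cnj a) z|\<close>
  on the circle, so the mean is 0, while log |a| is negative. If |a| > 1, factoring out a gives the
  mean log |a| exactly. Zeros off the circle keep the logarithm bounded.\<close>

lemma integral_log_linear_ge:
  assumes "norm a \<noteq> 1" "a \<noteq> 0"
  shows "integrable arclength (\<lambda>z. ln (norm (z - a)))" "2 * pi * ln (norm a) \<le> (LINT z|arclength. ln (norm (z - a)))"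
proof -
  have "integrable arclength (\<lambda>z. ln (norm (z - a))) \<and> 2 * pi * ln (norm a) \<le> (LINT z|arclength. ln (norm (z - a)))"
  proof (cases "norm a < 1")
    case True
    have eq: "ln (norm (z - a)) = ln (norm (1 - cnj a * z))" if "z \<in> space arclength" for z
    proof -
      have z: "z \<in> circle" using that by (simp only: space_arclength)
      have "norm (z - a) = norm (cnj z * (z - a))" using z by (simp add: norm_mult)
      also have "cnj z * (z - a) = cnj (1 - cnj a * z)"
        using mult_cnj_circle[OF z] by (simp add: algebra_simps)
      finally show ?thesis by (simp only: complex_mod_cnj)
    qed
    have "norm (cnj a) < 1" using True by simp
    note i = integral_log_one_minus[OF this]
    have "ln (norm a) \<le> 0" using True assms(2) by simp
    then have "2 * pi * ln (norm a) \<le> 0" by (simp add: mult_nonneg_nonpos)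
    moreover have "integrable arclength (\<lambda>z. ln (norm (z - a))) \<and>
        (LINT z|arclength. ln (norm (z - a))) = (LINT z|arclength. ln (norm (1 - cnj a * z)))"
      by (rule integral_arclength_cong[OF i(1)]) (rule eq)
    ultimately show ?thesis using i(2) by simp
  next
    case False
    then have "norm a > 1" using assms by simp
    then have ia: "norm (inverse a) < 1"
      using less_imp_inverse_less[of 1 "norm a"] by (simp add: norm_inverse)
    have eq: "ln (norm (z - a)) = ln (norm a) + ln (norm (1 - inverse a * z))" if "z \<in> space arclength" for z
    proof -
      have "norm (z - a) = norm a * norm (1 - inverse a * z)"
      proof -
        have "norm a * norm (1 - inverse a * z) = norm (a * (1 - inverse a * z))" by (simp only: norm_mult)
        also have "a * (1 - inverse a * z) = - (z - a)" using assms(2) by (simp add: right_diff_distrib)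
        finally show ?thesis by (simp only: norm_minus_cancel)
      qed
      moreover have "norm (inverse a * z) < 1"
        using that ia unfolding space_arclength norm_mult by simp
      then have "1 - inverse a * z \<noteq> 0" by auto
      ultimately show ?thesis using assms(2) by (simp add: ln_mult_pos)
    qed
    note i = integral_log_one_minus[OF ia]
    have c: "integrable arclength (\<lambda>_. ln (norm a))" by simp
    have "(LINT z|arclength. ln (norm a) + ln (norm (1 - inverse a * z))) = 2 * pi * ln (norm a)"
      unfolding Bochner_Integration.integral_add[OF c i(1)] i(2)
      by (simp add: space_arclength measure_arclength)
    moreover have "integrable arclength (\<lambda>z. ln (norm (z - a))) \<and>
        (LINT z|arclength. ln (norm (z - a))) = (LINT z|arclength. ln (norm a) + ln (norm (1 - inverse a * z)))"
      by (rule integral_arclength_cong[OF Bochner_Integration.integrable_add[OF c i(1)]]) (rule eq)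
    ultimately show ?thesis by simp
  qed
  then show "integrable arclength (\<lambda>z. ln (norm (z - a)))" "2 * pi * ln (norm a) \<le> (LINT z|arclength. ln (norm (z - a)))"
    by blast+
qed

text \<open>Induction on the degree, splitting off one zero. Integrability is carried along because
  the integrals of the two logarithms have to be added.\<close>

lemma integral_log_poly_ge:
  assumes "\<And>z. z \<in> circle \<Longrightarrow> poly q z \<noteq> 0" "poly q 0 \<noteq> 0"
  shows "integrable arclength (\<lambda>z. ln (norm (poly q z))) \<and>
    2 * pi * ln (norm (poly q 0)) \<le> (LINT z|arclength. ln (norm (poly q z)))"
  using assms
proof (induction "degree q" arbitrary: q)
  case 0
  then obtain c where "q = [:c:]" by (metis degree_0_id degree_eq_zeroE)
  then show ?case by (simp add: space_arclength measure_arclength)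
next
  case (Suc n)
  have "\<not> constant (poly q)" using Suc.hyps(2) by (simp add: constant_degree)
  then obtain a where a: "poly q a = 0" using fundamental_theorem_of_algebra by blast
  then obtain p where p: "q = [:- a, 1:] * p" by (auto simp: poly_eq_0_iff_dvd elim: dvdE)
  have "q \<noteq> 0" using Suc.prems(2) by auto
  then have "p \<noteq> 0" using p by auto
  then have "degree q = Suc (degree p)" unfolding p by (subst degree_mult_eq) auto
  then have dp: "n = degree p" using Suc.hyps(2) by simp
  have a0: "a \<noteq> 0" "norm a \<noteq> 1" using Suc.prems a by auto
  have pz: "poly q z = (z - a) * poly p z" for z by (simp add: p left_diff_distrib)
  have p1: "poly p z \<noteq> 0" if "z \<in> circle" for z using Suc.prems(1)[OF that] by (auto simp: pz)
  have p2: "poly p 0 \<noteq> 0" using Suc.prems(2) by (auto simp: pz)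
  have IH: "integrable arclength (\<lambda>z. ln (norm (poly p z))) \<and>
      2 * pi * ln (norm (poly p 0)) \<le> (LINT z|arclength. ln (norm (poly p z)))"
    by (rule Suc.hyps(1)[OF dp _ p2]) (rule p1)
  note lin = integral_log_linear_ge[OF a0(2,1)]
  have eq: "ln (norm (poly q z)) = ln (norm (z - a)) + ln (norm (poly p z))" if "z \<in> space arclength" for z
  proof -
    have z: "z \<in> circle" using that by (simp only: space_arclength)
    have "z \<noteq> a" using z a0(2) by auto
    then show ?thesis using p1[OF z] by (simp add: pz norm_mult ln_mult_pos)
  qed
  have "ln (norm (poly q 0)) = ln (norm a) + ln (norm (poly p 0))"
    using a0 p2 by (simp add: pz norm_mult ln_mult_pos)
  then have "2 * pi * ln (norm (poly q 0)) \<le> (LINT z|arclength. ln (norm (z - a)) + ln (norm (poly p z)))"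
    using lin IH unfolding Bochner_Integration.integral_add[OF lin(1) conjunct1[OF IH]]
    by (simp add: distrib_left)
  moreover have "integrable arclength (\<lambda>z. ln (norm (poly q z))) \<and>
      (LINT z|arclength. ln (norm (poly q z))) = (LINT z|arclength. ln (norm (z - a)) + ln (norm (poly p z)))"
    by (rule integral_arclength_cong[OF Bochner_Integration.integrable_add[OF lin(1) conjunct1[OF IH]]]) (rule eq)
  ultimately show ?case by simp
qed

text \<open>The inequality \<open>exp x \<ge> 1 + x\<close> is applied around the mean of the logarithm.\<close>

lemma szego_nonvanishing:
  assumes w: "integrable arclength w" "AE z in arclength. w z > 0" "integrable arclength (\<lambda>z. ln (w z))"
    and q: "\<And>z. z \<in> circle \<Longrightarrow> poly q z \<noteq> 0" "poly q 0 = 1"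
  shows "2 * pi * exp ((LINT z|arclength. ln (w z)) / (2 * pi)) \<le> (LINT z|arclength. (norm (poly q z))\<^sup>2 * w z)"
proof -
  have lq: "integrable arclength (\<lambda>z. ln (norm (poly q z)))" "0 \<le> (LINT z|arclength. ln (norm (poly q z)))"
    using integral_log_poly_ge[of q] q by auto
  define A where "A = (LINT z|arclength. ln (w z)) / (2 * pi)"
  let ?L = "\<lambda>z. exp A * ((1 - A) + (ln (w z) + 2 * ln (norm (poly q z))))"
  have i2: "integrable arclength (\<lambda>z. ln (w z) + 2 * ln (norm (poly q z)))"
    by (intro Bochner_Integration.integrable_add integrable_mult_right w lq)
  have iL: "integrable arclength ?L"
    by (intro integrable_mult_right Bochner_Integration.integrable_add i2) simp
  have qc: "continuous_on circle (\<lambda>z. (norm (poly q z))\<^sup>2)" by (intro continuous_intros)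
  obtain B where B: "\<forall>z\<in>circle. (norm (poly q z))\<^sup>2 \<le> B"
    using compact_imp_bounded[OF compact_continuous_image[OF qc compact_sphere]] unfolding bounded_iff by auto
  have iq: "integrable arclength (\<lambda>z. (norm (poly q z))\<^sup>2 * w z)"
  proof (rule Bochner_Integration.integrable_bound)
    show "integrable arclength (\<lambda>z. B * w z)" using w(1) by simp
    have "(\<lambda>z. (norm (poly q z))\<^sup>2) \<in> borel_measurable arclength"
      by (intro arclength.measurable_circle borel_measurable_continuous_onI continuous_intros)
    then show "(\<lambda>z. (norm (poly q z))\<^sup>2 * w z) \<in> borel_measurable arclength" using w(1) by measurable
    show "AE z in arclength. norm ((norm (poly q z))\<^sup>2 * w z) \<le> norm (B * w z)"
      using AE_space w(2)
    proof eventually_elim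
      case (elim z)
      then have "(norm (poly q z))\<^sup>2 \<le> B" using B by (simp only: space_arclength)
      then have "\<bar>(norm (poly q z))\<^sup>2\<bar> \<le> \<bar>B\<bar>" by simp
      then show ?case unfolding real_norm_def abs_mult by (rule mult_right_mono) simp
    qed
  qed
  have "AE z in arclength. ?L z \<le> (norm (poly q z))\<^sup>2 * w z"
    using AE_space w(2)
  proof eventually_elim
    case (elim z)
    then have qz: "poly q z \<noteq> 0" using q(1)[of z] unfolding space_arclength by blast
    let ?x = "ln (w z) + 2 * ln (norm (poly q z))"
    have "exp A * (1 + (?x - A)) \<le> exp A * exp (?x - A)"
      by (intro mult_left_mono exp_ge_add_one_self) simp
    also have "\<dots> = exp ?x" by (simp add: exp_diff)
    also have "\<dots> = (norm (poly q z))\<^sup>2 * w z"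
      using qz elim(2) by (simp add: exp_add mult_exp_exp[symmetric] exp_double mult.commute)
    finally show ?case by (simp add: algebra_simps)
  qed
  then have "(LINT z|arclength. ?L z) \<le> (LINT z|arclength. (norm (poly q z))\<^sup>2 * w z)"
    by (rule integral_mono_AE[OF iL iq])
  moreover have "(LINT z|arclength. ?L z) = exp A * (2 * pi * (1 - A) + ((LINT z|arclength. ln (w z)) + 2 * (LINT z|arclength. ln (norm (poly q z)))))"
  proof -
    have c: "integrable arclength (\<lambda>_. 1 - A)" by simp
    have i3: "integrable arclength (\<lambda>z. 2 * ln (norm (poly q z)))" using lq(1) by simp
    show ?thesis
      unfolding integral_mult_right_zero Bochner_Integration.integral_add[OF c i2] Bochner_Integration.integral_add[OF w(3) i3]
      by (simp add: space_arclength measure_arclength)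
  qed
  \<comment> \<open>The integral of \<open>ln (w z)\<close> is \<open>2 * pi * A\<close> and cancels
    the term with - A; what remains besides 2 pi is nonnegative by Jensen's inequality.\<close>
  moreover have "2 * pi \<le> 2 * pi * (1 - A) + ((LINT z|arclength. ln (w z)) + 2 * (LINT z|arclength. ln (norm (poly q z))))"
    using lq(2) by (simp add: A_def algebra_simps)
  then have "exp A * (2 * pi) \<le> exp A * (2 * pi * (1 - A) + ((LINT z|arclength. ln (w z)) + 2 * (LINT z|arclength. ln (norm (poly q z)))))"
    by (rule mult_left_mono) simp
  ultimately show ?thesis unfolding A_def[symmetric] by (simp only: mult.commute)
qed

text \<open>Dilating the polynomial moves its zeros away from the circle.\<close>

lemma szego:
  assumes w: "integrable arclength w" "AE z in arclength. w z > 0" "integrable arclength (\<lambda>z. ln (w z))"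
    and q: "poly q 0 = 1"
  shows "2 * pi * exp ((LINT z|arclength. ln (w z)) / (2 * pi)) \<le> (LINT z|arclength. (norm (poly q z))\<^sup>2 * w z)"
proof -
  have "q \<noteq> 0" using q by auto
  then have fin: "finite (norm ` {x. poly q x = 0})" by (intro finite_imageI poly_roots_finite)
  define r where "r j = 1 - 1 / real (j + 2)" for j
  have r: "0 \<le> r j" "r j \<le> 1" for j by (auto simp: r_def)
  have r1: "r \<longlonglongrightarrow> 1" unfolding r_def by real_asymp
  \<comment> \<open>The zeros have finitely many moduli and the radii are distinct, so only finitely
    many radii put a zero of the dilated polynomial on the circle.\<close>
  have "inj r" by (rule injI) (simp add: r_def)
  then have "finite (r -` (norm ` {x. poly q x = 0}))" using fin by (intro finite_vimageI)
  then have ev: "\<forall>\<^sub>F j in sequentially. r j \<notin> norm ` {x. poly q x = 0}"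
    by (auto simp: cofinite_eq_sequentially[symmetric] eventually_cofinite vimage_def)
  have qc: "continuous_on (cball 0 1) (\<lambda>z. (norm (poly q z))\<^sup>2)" by (intro continuous_intros)
  obtain B where B: "\<forall>z\<in>cball 0 1. (norm (poly q z))\<^sup>2 \<le> B"
    using compact_imp_bounded[OF compact_continuous_image[OF qc compact_cball]] unfolding bounded_iff by auto
  have "(\<lambda>j. LINT z|arclength. (norm (poly q (of_real (r j) * z)))\<^sup>2 * w z) \<longlonglongrightarrow> (LINT z|arclength. (norm (poly q z))\<^sup>2 * w z)"
  proof (rule integral_dominated_convergence[where w = "\<lambda>z. B * \<bar>w z\<bar>"])
    have meas: "(\<lambda>z. (norm (poly q (c * z)))\<^sup>2 * w z) \<in> borel_measurable arclength" for c
    proof -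
      have "(\<lambda>z. (norm (poly q (c * z)))\<^sup>2) \<in> borel_measurable arclength"
        by (intro arclength.measurable_circle borel_measurable_continuous_onI continuous_intros)
      then show ?thesis using w(1) by measurable
    qed
    show "(\<lambda>z. (norm (poly q z))\<^sup>2 * w z) \<in> borel_measurable arclength" using meas[of 1] by simp
    show "(\<lambda>z. (norm (poly q (of_real (r j) * z)))\<^sup>2 * w z) \<in> borel_measurable arclength" for j by (rule meas)
    show "integrable arclength (\<lambda>z. B * \<bar>w z\<bar>)" using w(1) by simp
    show "AE z in arclength. (\<lambda>j. (norm (poly q (of_real (r j) * z)))\<^sup>2 * w z) \<longlonglongrightarrow> (norm (poly q z))\<^sup>2 * w z"
    proof (rule AE_I2)
      fix z
      have "(\<lambda>j. (norm (poly q (of_real (r j) * z)))\<^sup>2 * w z) \<longlonglongrightarrow> (norm (poly q (of_real 1 * z)))\<^sup>2 * w z"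
        by (intro tendsto_intros r1 isCont_tendsto_compose[OF poly_isCont])
      then show "(\<lambda>j. (norm (poly q (of_real (r j) * z)))\<^sup>2 * w z) \<longlonglongrightarrow> (norm (poly q z))\<^sup>2 * w z" by simp
    qed
    show "AE z in arclength. norm ((norm (poly q (of_real (r j) * z)))\<^sup>2 * w z) \<le> B * \<bar>w z\<bar>" for j
    proof (rule AE_I2)
      fix z assume "z \<in> space arclength"
      then have "of_real (r j) * z \<in> cball 0 1" using r[of j] by (simp add: space_arclength norm_mult)
      then have "(norm (poly q (of_real (r j) * z)))\<^sup>2 \<le> B" using B by blast
      then show "norm ((norm (poly q (of_real (r j) * z)))\<^sup>2 * w z) \<le> B * \<bar>w z\<bar>"
        by (simp add: abs_mult mult_right_mono)
    qed
  qed
  moreover have "\<forall>\<^sub>F j in sequentially. 2 * pi * exp ((LINT z|arclength. ln (w z)) / (2 * pi))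
      \<le> (LINT z|arclength. (norm (poly q (of_real (r j) * z)))\<^sup>2 * w z)"
    using ev
  proof eventually_elim
    case (elim j)
    \<comment> \<open>Dilation keeps the value 1 at 0, so the lower bound is the same for every j
      and survives the limit.\<close>
    let ?q = "pcompose q [:0, of_real (r j):]"
    have pq: "poly ?q z = poly q (of_real (r j) * z)" for z by (simp add: poly_pcompose mult.commute)
    have "poly ?q z \<noteq> 0" if "z \<in> circle" for z
    proof
      assume "poly ?q z = 0"
      then have "poly q (of_real (r j) * z) = 0" by (simp only: pq)
      moreover have "norm (of_real (r j) * z) = r j" using that r(1)[of j] by (simp add: norm_mult)
      ultimately show False using elim by (metis (mono_tags, lifting) imageI mem_Collect_eq)
    qed
    moreover have "poly ?q 0 = 1" using q by (simp add: poly_pcompose)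
    ultimately show ?case using szego_nonvanishing[OF w, of ?q] unfolding pq by blast
  qed
  ultimately show ?thesis by (rule tendsto_lowerbound) simp
qed

lemma integral_log_eq_minus_infinity:
  assumes f: "f \<in> dirichlet_space" and cyc: "cyclic f"
  shows "ereal_integral arclength (\<lambda>z. elog (norm (f z))) = -\<infinity>"
proof -
  note [measurable] = dirichlet_spaceD(1)[OF f]
  \<comment> \<open>Since log x is at most x and \<open>f\<close> is integrable, the positive part
    is harmless; the claim reduces to an infinite negative part.\<close>
  have pos: "(\<integral>\<^sup>+z. e2ennreal (elog (norm (f z))) \<partial>arclength) < \<infinity>"
  proof -
    have le: "e2ennreal (elog (norm (f z))) \<le> ennreal (norm (f z))" for z
      using ln_le_minus_one[of "norm (f z)"] by (auto simp: elog_def e2ennreal_neg intro: ennreal_leI)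
    have "(\<integral>\<^sup>+z. e2ennreal (elog (norm (f z))) \<partial>arclength) \<le> (\<integral>\<^sup>+z. ennreal (norm (f z)) \<partial>arclength)"
      by (intro nn_integral_mono le)
    also have "\<dots> < \<infinity>" using dirichlet_spaceD(3)[OF f] by (simp add: integrable_iff_bounded)
    finally show ?thesis .
  qed
  have "(\<integral>\<^sup>+z. e2ennreal (- elog (norm (f z))) \<partial>arclength) = \<infinity>"
  proof (rule ccontr)
    assume fin: "(\<integral>\<^sup>+z. e2ennreal (- elog (norm (f z))) \<partial>arclength) \<noteq> \<infinity>"
    define w where "w z = (norm (f z))\<^sup>2" for z
    have wi: "integrable arclength w" using dirichlet_spaceD(2)[OF f] by (simp add: w_def[abs_def])
    \<comment> \<open>\<open>elog\<close> is - \<infinity> at 0, so a finite negative part excludes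
      zeros on a set of positive measure. This must be settled before \<open>ln\<close> replaces
      \<open>elog\<close>, as \<open>ln 0 = 0\<close> would hide them.\<close>
    have f0: "AE z in arclength. f z \<noteq> 0"
    proof -
      have "(\<lambda>z. e2ennreal (- elog (norm (f z)))) \<in> borel_measurable arclength" by measurable
      from nn_integral_PInf_AE[OF this] have "AE z in arclength. e2ennreal (- elog (norm (f z))) \<noteq> \<infinity>"
        using fin by simp
      then show ?thesis by eventually_elim (auto simp: elog_def)
    qed
    then have wp: "AE z in arclength. w z > 0" by eventually_elim (simp add: w_def)
    have lnf: "integrable arclength (\<lambda>z. ln (norm (f z)))"
    proof (rule integrableI_bounded)
      have "(\<integral>\<^sup>+z. ennreal (norm (ln (norm (f z)))) \<partial>arclength) \<le>
        (\<integral>\<^sup>+z. e2ennreal (elog (norm (f z))) + e2ennreal (- elog (norm (f z))) \<partial>arclength)"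
      proof (intro nn_integral_mono)
        fix z
        show "ennreal (norm (ln (norm (f z)))) \<le> e2ennreal (elog (norm (f z))) + e2ennreal (- elog (norm (f z)))"
          by (cases "ln (norm (f z)) \<ge> 0") (auto simp: elog_def abs_if ennreal_neg)
      qed
      also have "\<dots> = (\<integral>\<^sup>+z. e2ennreal (elog (norm (f z))) \<partial>arclength) + (\<integral>\<^sup>+z. e2ennreal (- elog (norm (f z))) \<partial>arclength)"
        by (rule nn_integral_add) measurable
      also have "\<dots> < \<infinity>" using pos fin by (simp add: less_top[symmetric])
      finally show "(\<integral>\<^sup>+z. ennreal (norm (ln (norm (f z)))) \<partial>arclength) < \<infinity>" .
    qed measurable
    have lnw: "integrable arclength (\<lambda>z. ln (w z))"
    proof -
      have "ln (w z) = 2 * ln (norm (f z))" for z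
        by (cases "f z = 0") (simp_all add: w_def ln_realpow)
      then show ?thesis using lnf by simp
    qed
    \<comment> \<open>The geometric mean of \<open>|f|\<^sup>2\<close> over the circle. It turns out
      to be a lower bound for the squared Dirichlet distance from
      \<open>\<zeta>\<^sup>-\<^sup>1 f\<close> to the span, and \<epsilon> is chosen with square A /
      2 to contradict this.\<close>
    define A where "A = exp ((LINT z|arclength. ln (w z)) / (2 * pi))"
    have "A > 0" by (simp add: A_def)
    define \<epsilon> where "\<epsilon> = sqrt (A / 2)"
    have eps: "\<epsilon> > 0" "\<epsilon>\<^sup>2 = A / 2" using \<open>A > 0\<close> by (auto simp: \<epsilon>_def)
    let ?g = "\<lambda>z. z powi (-1) * f z"
    have g: "?g \<in> dirichlet_space" by (rule dirichlet_space_shift[OF f])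
    then have "?g \<in> shift_closure f" using cyc by (simp add: cyclic_def)
    then obtain h where h: "h \<in> shift_span f" "dirichlet_norm (\<lambda>z. ?g z - h z) < \<epsilon>"
      using eps(1) unfolding shift_closure_def by blast
    then obtain a N where N: "finite N" and h_eq: "h = (\<lambda>z. \<Sum>n\<in>N. a n * (z ^ n * f z))"
      unfolding shift_span_def by blast
    \<comment> \<open>Multiplying \<open>?g z - h z\<close> by z clears the negative power and
      raises each exponent by one, which leaves 1 as the constant term.\<close>
    define q where "q = 1 - (\<Sum>n\<in>N. monom (a n) (Suc n))"
    have q: "poly q z = 1 - (\<Sum>n\<in>N. a n * z ^ Suc n)" for z
      by (simp add: q_def poly_sum poly_monom)
    have "poly q 0 = 1" by (simp add: q)
    note sz = szego[OF wi wp lnw this]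
    have "(\<lambda>z. ?g z - h z) \<in> dirichlet_space"
      using dirichlet_space_linear[OF g shift_span_dirichlet(1)[OF f N, of a, folded h_eq], of 1 "-1"] by simp
    note D = integral_norm_le_dirichlet_norm[OF this]
    have "(norm (?g z - h z))\<^sup>2 = (norm (poly q z))\<^sup>2 * w z" if "z \<in> space arclength" for z
    proof -
      have z: "z \<in> circle" "z \<noteq> 0" using that by (auto simp: space_arclength)
      have "?g z - h z = z powi (-1) * (poly q z * f z)"
      proof -
        have "z powi (-1) * (\<Sum>n\<in>N. a n * z ^ Suc n) = (\<Sum>n\<in>N. a n * z ^ n)"
        proof -
          have "inverse z * (a n * z ^ Suc n) = a n * z ^ n" for n using z(2) by simp
          then show ?thesis by (simp only: sum_distrib_left power_int_minus power_int_1_right)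
        qed
        then have "z powi (-1) * (poly q z * f z) = z powi (-1) * f z - (\<Sum>n\<in>N. a n * z ^ n) * f z"
          unfolding q left_diff_distrib right_diff_distrib mult.assoc[symmetric] by simp
        then show ?thesis by (simp add: h_eq sum_distrib_right mult.assoc)
      qed
      then show ?thesis using norm_powi_circle[OF z(1), of "- 1"] by (simp only: norm_mult w_def power_mult_distrib power_one mult_1)
    qed
    then have "(LINT z|arclength. (norm (?g z - h z))\<^sup>2) = (LINT z|arclength. (norm (poly q z))\<^sup>2 * w z)"
      by (intro Bochner_Integration.integral_cong refl)
    then have "2 * pi * A \<le> 2 * pi * (dirichlet_norm (\<lambda>z. ?g z - h z))\<^sup>2"
      using sz D unfolding A_def by linarith
    then have "A \<le> (dirichlet_norm (\<lambda>z. ?g z - h z))\<^sup>2" by simp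
    also have "\<dots> \<le> \<epsilon>\<^sup>2"
      using h(2) by (intro power_mono) (auto simp: dirichlet_norm_def infsum_nonneg)
    finally show False using eps(2) \<open>A > 0\<close> by simp
  qed
  moreover obtain x where "0 \<le> x" "(\<integral>\<^sup>+z. e2ennreal (elog (norm (f z))) \<partial>arclength) = ennreal x"
    using pos by (auto simp: less_top_ennreal)
  ultimately show ?thesis by (simp add: ereal_integral_def enn2ereal_ennreal)
qed

theorem theorem1:
  fixes f :: "complex \<Rightarrow> complex"
  assumes "f \<in> dirichlet_space"
    and "cyclic f"
  shows "ereal_integral arclength (\<lambda>\<zeta>. elog (norm (f \<zeta>))) = -\<infinity>
    \<and> log_capacity (zero_set f) = 0"
  using integral_log_eq_minus_infinity[OF assms] log_capacity_zero_set[OF assms] by blast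

end
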